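(* Let $p\ge3$, let $D\subseteq\mathbb{D}$ be an open set with the $p$-th Hindmarsh property, let $f:D\to\mathbb{C}$ and let $\kappa\ge0$ be an integer. Then $f\in\mathcal{S}_\kappa(D)$ if and only if $\mathbf{k}_n(f)=\mathbf{k}_{n+p}(f)=\kappa$ for some integer $n\ge0$.
   Context: $\mathbb{D}$ is the open unit disk. A Schur function is an analytic $S:\mathbb{D}\to\mathbb{C}$ with $|S|\le1$. Pick matrix: $P_n(f;z_1,\dots,z_n)=\left[\frac{1-f(z_i)\overline{f(z_j)}}{1-z_i\overline{z_j}}\right]_{i,j=1}^n$ for distinct $z_i\in D$. $\mathrm{sq}_-P$ = number of negative eigenvalues (with multiplicity) of a Hermitian $P$. $\mathbf{k}_n(f)=\max\mathrm{sq}_-P_n(f;z_1,\dots,z_n)$ over distinct $z_1,\dots,z_n\in D$, and $\mathbf{k}_0(f)=0$. $\mathcal{S}_\kappa(D)$ is the set of functions $f:D\to\mathbb{C}$ all of whose Pick matrices (at distinct points of $D$) have at most $\kappa$ negative eigenvalues, with at least one having exactly $\kappa$. For an integer $k\ge3$, an open set $D\subseteq\mathbb{D}$ has the $k$-th Hindmarsh property if every function $g:D\to\mathbb{C}$ such that $P_k(g;z_1,\dots,z_k)\ge0$ for all distinct $z_1,\dots,z_k\in D$ admits an extension to a Schur function on $\mathbb{D}$. *)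

theory Defs
  imports "HOL-Analysis.Analysis" "Jordan_Normal_Form.Char_Poly"
begin

definition pick_matrix :: "(complex \<Rightarrow> complex) \<Rightarrow> complex list \<Rightarrow> complex mat" where
  "pick_matrix f zs = mat (length zs) (length zs)
     (\<lambda>(i, j). (1 - f (zs ! i) * cnj (f (zs ! j))) / (1 - zs ! i * cnj (zs ! j)))"

text \<open>Number of negative eigenvalues counted with (algebraic = geometric, for Hermitian
  matrices) multiplicity: multiplicities of the negative real roots of the characteristic polynomial.\<close>
definition sq_minus :: "complex mat \<Rightarrow> nat" where
  "sq_minus A = (\<Sum>r \<in> {r::real. r < 0 \<and> poly (char_poly A) (complex_of_real r) = 0}.
                   order (complex_of_real r) (char_poly A))"

definition psd :: "complex mat \<Rightarrow> bool" where
  "psd A \<longleftrightarrow> A \<in> carrier_mat (dim_row A) (dim_row A) \<and>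
     (\<forall>v :: nat \<Rightarrow> complex.
        let q = (\<Sum>i<dim_row A. \<Sum>j<dim_row A. cnj (v i) * A $$ (i, j) * v j)
        in Im q = 0 \<and> Re q \<ge> 0)"

definition point_lists :: "complex set \<Rightarrow> nat \<Rightarrow> complex list set" where
  "point_lists D n = {zs. length zs = n \<and> distinct zs \<and> set zs \<subseteq> D}"

definition kn :: "complex set \<Rightarrow> (complex \<Rightarrow> complex) \<Rightarrow> nat \<Rightarrow> nat" where
  "kn D f n = Sup (sq_minus ` pick_matrix f ` point_lists D n)"

definition in_S_kappa :: "nat \<Rightarrow> complex set \<Rightarrow> (complex \<Rightarrow> complex) \<Rightarrow> bool" where
  "in_S_kappa \<kappa> D f \<longleftrightarrow>
     (\<forall>n. \<forall>zs \<in> point_lists D n. sq_minus (pick_matrix f zs) \<le> \<kappa>) \<and>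
     (\<exists>n. \<exists>zs \<in> point_lists D n. sq_minus (pick_matrix f zs) = \<kappa>)"

definition schur_function :: "(complex \<Rightarrow> complex) \<Rightarrow> bool" where
  "schur_function S \<longleftrightarrow> S holomorphic_on ball 0 1 \<and> (\<forall>z \<in> ball 0 1. norm (S z) \<le> 1)"

definition hindmarsh_property :: "nat \<Rightarrow> complex set \<Rightarrow> bool" where
  "hindmarsh_property k D \<longleftrightarrow>
     (\<forall>g. (\<forall>zs \<in> point_lists D k. psd (pick_matrix g zs)) \<longrightarrow>
          (\<exists>S. schur_function S \<and> (\<forall>z \<in> D. S z = g z)))"

end

theory Submission
  imports Defs "Jordan_Normal_Form.Schur_Decomposition" "HOL-Complex_Analysis.Riemann_Mapping"
begin

text \<open>
  Suppose \<open>k\<^sub>n(f) = k\<^sub>n\<^sub>+\<^sub>p(f) = \<kappa>\<close>. Choose a set \<open>Z\<close> of least cardinality whose Pick form has a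
  \<open>\<kappa>\<close>-dimensional negative subspace; minimality makes the Pick matrix of \<open>Z\<close> nonsingular. The Schur
  complement of this matrix in the Pick kernel of \<open>f\<close> is a kernel \<open>K\<close> on \<open>D - Z\<close> which is
  positive on any \<open>p\<close> points, since otherwise \<open>n + p\<close> points would carry \<open>\<kappa> + 1\<close> negative squares.
  The displacement structure of Pick matrices gives
  \<open>(1 - z w\<^sup>*) K(z, w) = a(z) a(w)\<^sup>* - c(z) c(w)\<^sup>*\<close>, where \<open>a\<close> has no zeros on \<open>D - Z\<close>, so
  \<open>K\<close> is up to scaling the Pick kernel of \<open>g = c / a\<close>. By the two-point Schwarz--Pick inequality
  \<open>g\<close> is locally Lipschitz, hence extends to \<open>D\<close> with positive \<open>p\<close>-point Pick matrices; by the Hindmarsh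
  property \<open>g\<close> is the restriction of a Schur function. Thus \<open>K\<close> is positive on every finite set,
  and adding points to \<open>Z\<close> never creates a further negative square.
\<close>

section \<open>Linear systems and Hermitian matrices\<close>

text \<open>Gaussian elimination by induction on the equations: a pivot removes one equation and one
  unknown, so the strict inequality of cardinalities survives. Index sets instead of matrices let
  the lemma act directly on sets of points.\<close>

lemma homogeneous_system_nontrivial_solution:
  fixes M :: "'a \<Rightarrow> 'b \<Rightarrow> 'c::field"
  assumes "finite X" "finite Y" "card X < card Y"
  shows "\<exists>c. (\<exists>y\<in>Y. c y \<noteq> 0) \<and> (\<forall>x\<in>X. (\<Sum>y\<in>Y. M x y * c y) = 0)"
  using assms
proof (induction X arbitrary: M Y rule: finite_induct)
  case empty
  then have "Y \<noteq> {}" by auto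
  then show ?case by (intro exI[of _ "\<lambda>_. 1"]) auto
next
  case (insert x X)
  show ?case
  proof (cases "\<forall>y\<in>Y. M x y = 0")
    case True
    obtain c where "\<exists>y\<in>Y. c y \<noteq> 0" "\<forall>x\<in>X. (\<Sum>y\<in>Y. M x y * c y) = 0"
      using insert.IH[of Y M] insert.prems insert.hyps by auto
    with True show ?thesis by (intro exI[of _ c]) auto
  next
    case False
    then obtain y0 where y0: "y0 \<in> Y" "M x y0 \<noteq> 0" by auto
    have "card X < card (Y - {y0})" using insert.prems insert.hyps y0 by auto
    then obtain c where c: "\<exists>y\<in>Y - {y0}. c y \<noteq> 0"
      "\<forall>x'\<in>X. (\<Sum>y\<in>Y - {y0}. (M x' y - M x' y0 / M x y0 * M x y) * c y) = 0"
      using insert.IH[of "Y - {y0}" "\<lambda>x' y. M x' y - M x' y0 / M x y0 * M x y"] insert.prems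
      by auto
    define s where "s = (\<Sum>y\<in>Y - {y0}. M x y * c y)"
    \<comment> \<open>The eliminated unknown \<open>y0\<close> gets the value that equation
      \<open>x\<close> dictates.\<close>
    define c' where "c' = c(y0 := - s / M x y0)"
    have eq: "(\<Sum>y\<in>Y. M x' y * c' y) = (\<Sum>y\<in>Y - {y0}. M x' y * c y) - M x' y0 / M x y0 * s" for x'
    proof -
      have "(\<Sum>y\<in>Y. M x' y * c' y) = M x' y0 * c' y0 + (\<Sum>y\<in>Y - {y0}. M x' y * c' y)"
        using y0 insert.prems by (subst sum.remove[of Y y0]) auto
      also have "(\<Sum>y\<in>Y - {y0}. M x' y * c' y) = (\<Sum>y\<in>Y - {y0}. M x' y * c y)"
        by (rule sum.cong) (auto simp: c'_def)
      finally show ?thesis by (simp add: c'_def)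
    qed
    have "\<exists>y\<in>Y. c' y \<noteq> 0" using c(1) by (auto simp: c'_def)
    moreover have "(\<Sum>y\<in>Y. M x y * c' y) = 0"
      using y0 by (simp add: eq s_def)
    moreover have "(\<Sum>y\<in>Y. M x' y * c' y) = 0" if "x' \<in> X" for x'
    proof -
      have "(\<Sum>y\<in>Y - {y0}. (M x' y - M x' y0 / M x y0 * M x y) * c y)
          = (\<Sum>y\<in>Y - {y0}. M x' y * c y) - M x' y0 / M x y0 * s"
        unfolding s_def sum_distrib_left sum_subtractf[symmetric]
        by (rule sum.cong) (auto simp: algebra_simps)
      then show ?thesis using c(2) that by (simp add: eq)
    qed
    ultimately show ?thesis by (intro exI[of _ c']) auto
  qed
qed

text \<open>The right-hand side \<open>b\<close> is adjoined as an extra column, labelled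
  \<open>None\<close>, giving one unknown more than equations. In a nontrivial solution injectivity
  forbids a zero coefficient on \<open>b\<close>, so one can divide by it.\<close>

lemma nonsingular_system_solvable:
  fixes M :: "'a \<Rightarrow> 'a \<Rightarrow> 'c::field"
  assumes fin: "finite Z"
    and inj: "\<And>x. (\<And>z. z \<in> Z \<Longrightarrow> (\<Sum>w\<in>Z. M z w * x w) = 0) \<Longrightarrow> \<forall>w\<in>Z. x w = 0"
  shows "\<exists>x. \<forall>z\<in>Z. (\<Sum>w\<in>Z. M z w * x w) = b z"
proof -
  define N where "N = (\<lambda>z y. case y of None \<Rightarrow> b z | Some w \<Rightarrow> - M z w)"
  define Y where "Y = insert None (Some ` Z)"
  have Y: "finite Y" "card Y = Suc (card Z)"
    using fin by (auto simp: Y_def card_image)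
  have sumY: "(\<Sum>y\<in>Y. N z y * c y) = b z * c None - (\<Sum>w\<in>Z. M z w * c (Some w))" for z c
    using fin by (simp add: Y_def N_def sum.reindex sum_negf)
  obtain c where c: "\<exists>y\<in>Y. c y \<noteq> 0" "\<forall>z\<in>Z. (\<Sum>y\<in>Y. N z y * c y) = 0"
    using homogeneous_system_nontrivial_solution[of Z Y N] fin Y by auto
  have c0: "c None \<noteq> 0"
  proof
    assume 0: "c None = 0"
    have "(\<Sum>w\<in>Z. M z w * c (Some w)) = 0" if "z \<in> Z" for z
      using c(2) that 0 sumY[of z c] by simp
    then have "\<forall>w\<in>Z. c (Some w) = 0" by (rule inj)
    with 0 c(1) show False by (auto simp: Y_def)
  qed
  have "(\<Sum>w\<in>Z. M z w * (c (Some w) / c None)) = b z" if "z \<in> Z" for z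
  proof -
    have "(\<Sum>w\<in>Z. M z w * (c (Some w) / c None)) = (\<Sum>w\<in>Z. M z w * c (Some w)) / c None"
      by (simp add: sum_divide_distrib)
    also have "(\<Sum>w\<in>Z. M z w * c (Some w)) = b z * c None"
      using c(2) that sumY[of z c] by simp
    finally show ?thesis using c0 by simp
  qed
  then show ?thesis by (intro exI[of _ "\<lambda>w. c (Some w) / c None"]) simp
qed

section \<open>Unitary diagonalisation of Hermitian matrices\<close>

abbreviation ctranspose :: "complex mat \<Rightarrow> complex mat" where
  "ctranspose A \<equiv> map_mat cnj (transpose_mat A)"

lemma ctranspose_mult:
  assumes "A \<in> carrier_mat n m" "B \<in> carrier_mat m l"
  shows "ctranspose (A * B) = ctranspose B * ctranspose A"
  using assms by (auto intro!: eq_matI simp: scalar_prod_def mult.commute)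

text \<open>Basis completion and Gram-Schmidt keep \<open>v\<close> as first vector; normalising the
  resulting orthogonal vectors gives the columns, and \<open>c\<close> is the normalising factor of
  the first.\<close>

lemma unitary_mat_with_first_col:
  fixes v :: "complex Matrix.vec"
  assumes v: "v \<in> carrier_vec n" and v0: "v \<noteq> 0\<^sub>v n"
  shows "\<exists>W c. W \<in> carrier_mat n n \<and> ctranspose W * W = 1\<^sub>m n \<and> col W 0 = c \<cdot>\<^sub>v v"
proof -
  interpret vec_space "TYPE(complex)" n .
  note bc = basis_completion[OF v v0]
  define ws where "ws = gram_schmidt n (basis_completion v)"
  have ws: "set ws \<subseteq> carrier_vec n" "corthogonal ws" "length ws = n"
    using cof_vec_space.gram_schmidt_result[OF bc(2) bc(4) bc(5) ws_def] bc(6) by auto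
  have n0: "n > 0"
    using v v0 by (cases n) auto
  have hd: "ws ! 0 = v"
    using cof_vec_space.gram_schmidt_hd[OF v, of "tl (basis_completion v)"] bc(6,7) n0 ws(3)
    unfolding ws_def by (cases "basis_completion v"; cases "gram_schmidt n (basis_completion v)") auto
  define r where "r = (\<lambda>i. complex_of_real (1 / sqrt (Re (ws ! i \<bullet>c ws ! i))))"
  define W where "W = mat_of_cols n (map (\<lambda>i. r i \<cdot>\<^sub>v ws ! i) [0..<n])"
  have W: "W \<in> carrier_mat n n" by (auto simp: W_def mat_of_cols_def)
  have wsi: "ws ! i \<in> carrier_vec n" if "i < n" for i using ws that by auto
  have Wij: "W $$ (i, j) = r j * vec_index (ws ! j) i" if "i < n" "j < n" for i j
    using that wsi[of j] by (auto simp: W_def mat_of_cols_def)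
  have self: "cnj (r i) * r i * (ws ! i \<bullet>c ws ! i) = 1" if "i < n" for i
  proof -
    let ?q = "ws ! i \<bullet>c ws ! i"
    have "?q \<noteq> 0" using ws(2,3) that by (auto simp: corthogonal_def)
    define q where "q = (\<Sum>l<n. (cmod (vec_index (ws ! i) l))\<^sup>2)"
    have q: "?q = complex_of_real q"
      unfolding q_def of_real_sum complex_norm_square using carrier_vecD[OF wsi[OF that]]
      by (simp add: scalar_prod_def atLeast0LessThan)
    have "q \<ge> 0" unfolding q_def by (intro sum_nonneg) simp
    with q \<open>?q \<noteq> 0\<close> have "q > 0" by (cases "q = 0") auto
    have "cnj (r i) * r i = complex_of_real (1 / q)"
      using \<open>q > 0\<close> unfolding r_def q by (simp flip: of_real_mult)
    then show ?thesis using q \<open>q > 0\<close> by (simp flip: of_real_mult)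
  qed
  have "ctranspose W * W = 1\<^sub>m n"
  proof (rule eq_matI)
    fix i j assume "i < dim_row (1\<^sub>m n :: complex mat)" "j < dim_col (1\<^sub>m n :: complex mat)"
    then have ij: "i < n" "j < n" by auto
    have "(ctranspose W * W) $$ (i, j) = (\<Sum>l<n. cnj (W $$ (l, i)) * W $$ (l, j))"
      using W ij by (auto simp: scalar_prod_def atLeast0LessThan)
    also have "\<dots> = (\<Sum>l<n. cnj (r i) * r j * (vec_index (ws ! j) l * cnj (vec_index (ws ! i) l)))"
      using ij by (intro sum.cong) (auto simp: Wij)
    also have "\<dots> = cnj (r i) * r j * (ws ! j \<bullet>c ws ! i)"
      using carrier_vecD[OF wsi[OF ij(1)]] carrier_vecD[OF wsi[OF ij(2)]] ij
      by (simp add: scalar_prod_def atLeast0LessThan sum_distrib_left)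
    also have "\<dots> = (if i = j then 1 else 0)"
      using ws(2,3) ij self by (auto simp: corthogonal_def)
    finally show "(ctranspose W * W) $$ (i, j) = 1\<^sub>m n $$ (i, j)" using ij by auto
  qed (use W in auto)
  moreover have "col W 0 = r 0 \<cdot>\<^sub>v v"
    using n0 v hd wsi[of 0] by (auto simp: W_def)
  ultimately show ?thesis using W by blast
qed

definition rdiag :: "nat \<Rightarrow> (nat \<Rightarrow> real) \<Rightarrow> complex mat" where
  "rdiag n d = mat n n (\<lambda>(i, j). if i = j then complex_of_real (d i) else 0)"

lemma rdiag_carrier [simp]: "rdiag n d \<in> carrier_mat n n"
  by (simp add: rdiag_def)

lemma unitary_four_block:
  assumes "U \<in> carrier_mat n n" "ctranspose U * U = 1\<^sub>m n"
  defines "V \<equiv> four_block_mat (1\<^sub>m 1) (0\<^sub>m 1 n) (0\<^sub>m n 1) U"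
  shows "V \<in> carrier_mat (Suc n) (Suc n)"
    and "ctranspose V = four_block_mat (1\<^sub>m 1) (0\<^sub>m 1 n) (0\<^sub>m n 1) (ctranspose U)"
    and "ctranspose V * V = 1\<^sub>m (Suc n)"
proof -
  show "V \<in> carrier_mat (Suc n) (Suc n)" using assms by auto
  show tV: "ctranspose V = four_block_mat (1\<^sub>m 1) (0\<^sub>m 1 n) (0\<^sub>m n 1) (ctranspose U)"
    using assms by (intro eq_matI) auto
  have "ctranspose V * V = four_block_mat (1\<^sub>m 1) (0\<^sub>m 1 n) (0\<^sub>m n 1) (ctranspose U * U)"
    unfolding tV unfolding V_def using assms
    by (subst mult_four_block_mat[of _ 1 1 _ n _ n _ _ 1 _ n]) auto
  also have "\<dots> = 1\<^sub>m (Suc n)"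
    using assms by (intro eq_matI) auto
  finally show "ctranspose V * V = 1\<^sub>m (Suc n)" .
qed

text \<open>Deflation: conjugation by a unitary matrix whose first column is an eigenvector clears
  the first column below the diagonal, Hermitian symmetry clears the first row, and the induction
  hypothesis treats the remaining block.\<close>

theorem hermitian_mat_spectral:
  assumes "A \<in> carrier_mat n n" "ctranspose A = A"
  shows "\<exists>U d. U \<in> carrier_mat n n \<and> ctranspose U * U = 1\<^sub>m n \<and> A = U * rdiag n d * ctranspose U"
  using assms
proof (induction n arbitrary: A)
  case 0
  then show ?case
    by (intro exI[of _ "1\<^sub>m 0"] exI[of _ "\<lambda>_. 0"] conjI eq_matI) auto
next
  case (Suc n)
  note A = Suc.prems(1)
  have "degree (char_poly A) = Suc n" using degree_monic_char_poly[OF A] by simp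
  then have "\<not> constant (poly (char_poly A))" by (simp add: constant_degree)
  then obtain e where "poly (char_poly A) e = 0"
    using Fundamental_Theorem_Algebra.fundamental_theorem_of_algebra[of "char_poly A"] by auto
  then have "eigenvalue A e" using eigenvalue_root_char_poly[OF A] by simp
  then obtain v where v: "v \<in> carrier_vec (Suc n)" "v \<noteq> 0\<^sub>v (Suc n)" "A *\<^sub>v v = e \<cdot>\<^sub>v v"
    using A unfolding eigenvalue_def eigenvector_def by auto
  obtain W c where W: "W \<in> carrier_mat (Suc n) (Suc n)" "ctranspose W * W = 1\<^sub>m (Suc n)"
    "col W 0 = c \<cdot>\<^sub>v v"
    using unitary_mat_with_first_col[OF v(1,2)] by blast
  have tW: "ctranspose W \<in> carrier_mat (Suc n) (Suc n)" using W by auto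
  have WW: "W * ctranspose W = 1\<^sub>m (Suc n)"
    using mat_mult_left_right_inverse[OF tW W(1) W(2)] .
  define B where "B = ctranspose W * (A * W)"
  have B: "B \<in> carrier_mat (Suc n) (Suc n)" using A W by (auto simp: B_def)
  have AW: "A * W \<in> carrier_mat (Suc n) (Suc n)" using A W by auto
  have tB: "ctranspose B = B"
  proof -
    have "ctranspose (ctranspose W) = W" by (intro eq_matI) auto
    then have "ctranspose B = ctranspose (A * W) * W"
      unfolding B_def using ctranspose_mult[OF tW AW] by simp
    also have "ctranspose (A * W) = ctranspose W * A"
      using ctranspose_mult[OF A W(1)] Suc.prems(2) by simp
    also have "\<dots> * W = B"
      unfolding B_def by (rule assoc_mult_mat[OF tW A W(1)])
    finally show ?thesis .
  qed
  have colB: "col B 0 = e \<cdot>\<^sub>v unit_vec (Suc n) 0"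
  proof -
    have "col B 0 = ctranspose W *\<^sub>v (A *\<^sub>v col W 0)"
      unfolding B_def using col_mult2[OF A W(1), of 0] col_mult2[OF tW AW, of 0]
      by simp
    also have "A *\<^sub>v col W 0 = e \<cdot>\<^sub>v col W 0"
      using v A by (simp add: W(3) mult_mat_vec[of _ "Suc n" "Suc n"] smult_smult_assoc mult.commute)
    also have "ctranspose W *\<^sub>v (e \<cdot>\<^sub>v col W 0) = e \<cdot>\<^sub>v col (ctranspose W * W) 0"
      using col_mult2[OF tW W(1), of 0] mult_mat_vec[OF tW, of "col W 0" e] W(1)
      by (simp add: carrier_vecI)
    finally show ?thesis by (simp add: W(2))
  qed
  have B0: "B $$ (i, 0) = (if i = 0 then e else 0)" if "i < Suc n" for i
    using arg_cong[OF colB, of "\<lambda>x. vec_index x i"] that B by auto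
  have Bsym: "B $$ (i, j) = cnj (B $$ (j, i))" if "i < Suc n" "j < Suc n" for i j
    using arg_cong[OF tB, of "\<lambda>x. x $$ (i, j)"] that B by auto
  \<comment> \<open>The eigenvalue is a diagonal entry of the Hermitian matrix
    \<open>B\<close>.\<close>
  have e_real: "e = complex_of_real (Re e)"
    using Bsym[of 0 0] B0[of 0] by (auto simp: complex_eq_iff)
  define B' where "B' = mat n n (\<lambda>(i, j). B $$ (Suc i, Suc j))"
  have B': "B' \<in> carrier_mat n n" by (simp add: B'_def)
  have "ctranspose B' = B'"
  proof (rule eq_matI)
    fix i j assume "i < dim_row B'" "j < dim_col B'"
    then show "ctranspose B' $$ (i, j) = B' $$ (i, j)"
      using Bsym[of "Suc i" "Suc j"] by (simp add: B'_def)
  qed (auto simp: B'_def)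
  from Suc.IH[OF B' this] obtain U d where U: "U \<in> carrier_mat n n" "ctranspose U * U = 1\<^sub>m n"
    "B' = U * rdiag n d * ctranspose U"
    by blast
  define V where "V = four_block_mat (1\<^sub>m 1) (0\<^sub>m 1 n) (0\<^sub>m n 1) U"
  note V = unitary_four_block[OF U(1,2), folded V_def]
  define d' where "d' = case_nat (Re e) d"
  have rd': "rdiag (Suc n) d' = four_block_mat (mat 1 1 (\<lambda>_. e)) (0\<^sub>m 1 n) (0\<^sub>m n 1) (rdiag n d)"
    using e_real by (intro eq_matI) (auto simp: rdiag_def d'_def split: nat.splits)
  have tU: "ctranspose U \<in> carrier_mat n n" using U by auto
  have tV: "ctranspose V \<in> carrier_mat (Suc n) (Suc n)" using V(1) by auto
  have "V * rdiag (Suc n) d' = four_block_mat (mat 1 1 (\<lambda>_. e)) (0\<^sub>m 1 n) (0\<^sub>m n 1) (U * rdiag n d)"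
    unfolding rd' V_def using U(1) left_mult_zero_mat[OF rdiag_carrier, of 1 n d]
    by (subst mult_four_block_mat[of _ 1 1 _ n _ n _ _ 1 _ n]) auto
  also have "\<dots> * ctranspose V = four_block_mat (mat 1 1 (\<lambda>_. e)) (0\<^sub>m 1 n) (0\<^sub>m n 1) B'"
    unfolding V(2) U(3) using U(1) tU right_mult_zero_mat[of "U * rdiag n d" n n 1]
      left_add_zero_mat[of "U * rdiag n d * ctranspose U" n n]
    by (subst mult_four_block_mat[of _ 1 1 _ n _ n _ _ 1 _ n]) auto
  also have "\<dots> = B"
  proof (rule eq_matI)
    fix i j assume "i < dim_row B" "j < dim_col B"
    then have ij: "i < Suc n" "j < Suc n" using B by auto
    have "B $$ (0, j) = (if j = 0 then e else 0)"
      using Bsym[of 0 j] B0[of j] ij e_real by (auto simp: complex_eq_iff)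
    then show "four_block_mat (mat 1 1 (\<lambda>_. e)) (0\<^sub>m 1 n) (0\<^sub>m n 1) B' $$ (i, j) = B $$ (i, j)"
      using ij B0[of i] B' by (cases i; cases j) (auto simp: B'_def)
  qed (use B B' in auto)
  finally have VB: "V * rdiag (Suc n) d' * ctranspose V = B" .
  have WBW: "W * B * ctranspose W = A"
  proof -
    have "W * B * ctranspose W = (W * ctranspose W) * A * (W * ctranspose W)"
      unfolding B_def using A W(1) tW by (simp add: assoc_mult_mat[of _ "Suc n" "Suc n" _ "Suc n" _ "Suc n"])
    then show ?thesis using A by (simp add: WW)
  qed
  have tWV: "ctranspose (W * V) = ctranspose V * ctranspose W"
    by (rule ctranspose_mult[OF W(1) V(1)])
  have "ctranspose (W * V) * (W * V) = ctranspose V * ((ctranspose W * W) * V)"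
    unfolding tWV using W(1) tW V(1) tV by (simp add: assoc_mult_mat[of _ "Suc n" "Suc n" _ "Suc n" _ "Suc n"])
  also have "\<dots> = 1\<^sub>m (Suc n)" using V by (simp add: W(2))
  finally have "ctranspose (W * V) * (W * V) = 1\<^sub>m (Suc n)" .
  moreover have "A = (W * V) * rdiag (Suc n) d' * ctranspose (W * V)"
    unfolding tWV WBW[symmetric] VB[symmetric] using W(1) tW V(1) tV
    by (simp add: mult_carrier_mat[of _ "Suc n" "Suc n" _ "Suc n"] assoc_mult_mat[of _ "Suc n" "Suc n" _ "Suc n" _ "Suc n"])
  moreover have "W * V \<in> carrier_mat (Suc n) (Suc n)" using W(1) V(1) by simp
  ultimately show ?case by blast
qed

section \<open>Counting negative eigenvalues\<close>

lemma order_prod_linear_factors: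
  "Polynomial.order a (\<Prod>b\<leftarrow>bs. [:- b, 1:]) = length (filter (\<lambda>b. b = a) bs)" for a :: "'a::field"
proof (induction bs)
  case Nil
  then show ?case by simp
next
  case (Cons b bs)
  let ?p = "\<Prod>b\<leftarrow>bs. [:- b, 1:]"
  have "?p \<noteq> 0" by (auto simp: prod_list_zero_iff)
  then have "[:- b, 1:] * ?p \<noteq> 0" by (intro no_zero_divisors) auto
  then have "Polynomial.order a ([:- b, 1:] * ?p) = Polynomial.order a [:- b, 1:] + Polynomial.order a ?p"
    by (rule order_mult)
  moreover have "Polynomial.order a [:- b, 1:] = (if b = a then 1 else 0)"
  proof (cases "b = a")
    case True
    then show ?thesis using order_power_n_n[of a 1] by simp
  qed (simp add: order_0I)
  ultimately show ?case using Cons by (simp del: mult_pCons_left)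
qed

text \<open>Unitary conjugation is a similarity, so the characteristic polynomial is that of the
  diagonal matrix, and the multiplicity of the root \<open>r\<close> counts the indices with
  \<open>d i = r\<close>.\<close>

lemma sq_minus_unitary_rdiag:
  assumes U: "U \<in> carrier_mat n n" "ctranspose U * U = 1\<^sub>m n"
    and A: "A = U * rdiag n d * ctranspose U"
  shows "sq_minus A = card {i. i < n \<and> d i < 0}"
proof -
  have tU: "ctranspose U \<in> carrier_mat n n" using U by auto
  have "U * ctranspose U = 1\<^sub>m n"
    using mat_mult_left_right_inverse[OF tU U(1) U(2)] .
  then have "similar_mat A (rdiag n d)"
    unfolding similar_mat_def
    by (intro exI[of _ U] exI[of _ "ctranspose U"] similar_mat_witI[where n = n])
      (use U tU A in \<open>auto intro!: mult_carrier_mat[of _ n n]\<close>)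
  then have "char_poly A = char_poly (rdiag n d)" by (rule char_poly_similar)
  also have "\<dots> = (\<Prod>b\<leftarrow>diag_mat (rdiag n d). [:- b, 1:])"
    by (rule char_poly_upper_triangular[OF rdiag_carrier]) (simp add: rdiag_def upper_triangular_def)
  also have "diag_mat (rdiag n d) = map (\<lambda>i. complex_of_real (d i)) [0..<n]"
    by (simp add: diag_mat_def rdiag_def)
  finally have cp: "char_poly A = (\<Prod>b\<leftarrow>map (\<lambda>i. complex_of_real (d i)) [0..<n]. [:- b, 1:])" .
  have ord: "Polynomial.order (complex_of_real r) (char_poly A) = card {i. i < n \<and> d i = r}" for r
  proof -
    have "Polynomial.order (complex_of_real r) (char_poly A) = length (filter (\<lambda>i. d i = r) [0..<n])"
      unfolding cp order_prod_linear_factors by (simp add: filter_map o_def)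
    also have "\<dots> = card (set (filter (\<lambda>i. d i = r) [0..<n]))"
      by (rule distinct_card[symmetric]) simp
    also have "set (filter (\<lambda>i. d i = r) [0..<n]) = {i. i < n \<and> d i = r}" by auto
    finally show ?thesis .
  qed
  have root: "poly (char_poly A) (complex_of_real r) = 0 \<longleftrightarrow> (\<exists>i<n. d i = r)" for r
    unfolding cp poly_prod_list by (auto simp: prod_list_zero_iff)
  \<comment> \<open>Summing the sizes of the fibres of \<open>d\<close> over the distinct negative
    values counts every negative index once.\<close>
  have "sq_minus A = (\<Sum>r\<in>d ` {i. i < n \<and> d i < 0}. card {i. i < n \<and> d i = r})"
    unfolding sq_minus_def root ord by (rule sum.cong) auto
  also have "\<dots> = (\<Sum>r\<in>d ` {i. i < n \<and> d i < 0}. card {i \<in> {i. i < n \<and> d i < 0}. d i = r})"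
    by (rule sum.cong) (auto intro!: arg_cong[of _ _ card])
  also have "\<dots> = card {i. i < n \<and> d i < 0}"
    using sum.image_gen[of "{i. i < n \<and> d i < 0}" "\<lambda>_. 1 :: nat" d] by simp
  finally show ?thesis .
qed

section \<open>Hermitian forms and negative squares\<close>

definition hform :: "('a \<Rightarrow> 'a \<Rightarrow> complex) \<Rightarrow> 'a set \<Rightarrow> ('a \<Rightarrow> complex) \<Rightarrow> complex" where
  "hform k Z x = (\<Sum>z\<in>Z. \<Sum>w\<in>Z. cnj (x z) * k z w * x w)"

text \<open>The number of negative squares is trapped between the size of a negative family, spanning a
  negative definite subspace, and the number of functionals \<open>L\<close> on whose common kernel the form is
  nonnegative.\<close>

definition negative_family :: "('a \<Rightarrow> 'a \<Rightarrow> complex) \<Rightarrow> 'a set \<Rightarrow> nat \<Rightarrow> (nat \<Rightarrow> 'a \<Rightarrow> complex) \<Rightarrow> bool" where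
  "negative_family k Z m V \<longleftrightarrow>
     (\<forall>c. (\<exists>i<m. c i \<noteq> 0) \<longrightarrow> Re (hform k Z (\<lambda>z. \<Sum>i<m. c i * V i z)) < 0)"

definition nonneg_on_kernel :: "('a \<Rightarrow> 'a \<Rightarrow> complex) \<Rightarrow> 'a set \<Rightarrow> nat \<Rightarrow> (nat \<Rightarrow> 'a \<Rightarrow> complex) \<Rightarrow> bool" where
  "nonneg_on_kernel k Z m L \<longleftrightarrow>
     (\<forall>x. (\<forall>i<m. (\<Sum>z\<in>Z. L i z * x z) = 0) \<longrightarrow> Re (hform k Z x) \<ge> 0)"

lemma hform_cong:
  assumes "\<And>z. z \<in> Z \<Longrightarrow> x z = y z"
  shows "hform k Z x = hform k Z y"
  unfolding hform_def by (intro sum.cong refl) (simp add: assms)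

text \<open>Inertia argument: if \<open>m > l\<close>, some nontrivial combination of the
  \<open>m\<close> vectors is killed by all \<open>l\<close> functionals, and there the form would
  be both negative and nonnegative.\<close>

lemma negative_family_le_kernel:
  assumes V: "negative_family k Z m V" and L: "nonneg_on_kernel k Z l L"
  shows "m \<le> l"
proof (rule ccontr)
  assume "\<not> m \<le> l"
  then obtain c where c: "\<exists>j\<in>{..<m}. c j \<noteq> 0"
    "\<forall>i\<in>{..<l}. (\<Sum>j<m. (\<Sum>z\<in>Z. L i z * V j z) * c j) = 0"
    using homogeneous_system_nontrivial_solution[of "{..<l}" "{..<m}" "\<lambda>i j. \<Sum>z\<in>Z. L i z * V j z"]
    by auto
  have "(\<Sum>z\<in>Z. L i z * (\<Sum>j<m. c j * V j z)) = (\<Sum>j<m. (\<Sum>z\<in>Z. L i z * V j z) * c j)" for i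
    unfolding sum_distrib_left sum_distrib_right
    by (subst sum.swap) (simp add: mult_ac)
  then have "Re (hform k Z (\<lambda>z. \<Sum>j<m. c j * V j z)) \<ge> 0"
    using L c(2) unfolding nonneg_on_kernel_def by simp
  moreover have "Re (hform k Z (\<lambda>z. \<Sum>j<m. c j * V j z)) < 0"
    using V c(1) unfolding negative_family_def by auto
  ultimately show False by simp
qed

lemma sum_nth_distinct:
  assumes "distinct zs"
  shows "(\<Sum>i<length zs. g (zs ! i)) = sum g (set zs)"
  using sum.reindex_bij_betw[OF bij_betw_nth[OF assms refl refl], of g] by (simp add: atLeast0LessThan)

lemma hform_set:
  assumes "distinct zs"
  shows "hform k (set zs) x =
    (\<Sum>i<length zs. \<Sum>j<length zs. cnj (x (zs ! i)) * k (zs ! i) (zs ! j) * x (zs ! j))"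
  unfolding hform_def by (simp add: sum_nth_distinct[OF assms, symmetric])

lemma obtain_on_distinct_list:
  assumes "distinct zs"
  obtains x where "\<And>i. i < length zs \<Longrightarrow> x (zs ! i) = v i"
proof
  fix i assume "i < length zs"
  then have "inv_into {..<length zs} ((!) zs) (zs ! i) = i"
    using assms by (intro inv_into_f_f) (auto simp: inj_on_nth)
  then show "(v \<circ> inv_into {..<length zs} ((!) zs)) (zs ! i) = v i" by simp
qed

definition kernel_matrix :: "('a \<Rightarrow> 'a \<Rightarrow> complex) \<Rightarrow> 'a list \<Rightarrow> complex mat" where
  "kernel_matrix k zs = mat (length zs) (length zs) (\<lambda>(i, j). k (zs ! i) (zs ! j))"

definition hermitian_kernel :: "('a \<Rightarrow> 'a \<Rightarrow> complex) \<Rightarrow> bool" where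
  "hermitian_kernel k \<longleftrightarrow> (\<forall>z w. cnj (k z w) = k w z)"

text \<open>Eigenvectors with negative eigenvalue form the family \<open>V\<close>, and the
  coordinates along them are the functionals \<open>L\<close>. Together with
  \<open>negative_family_le_kernel\<close> this expresses \<open>sq_minus\<close> through the form
  on a set of points, so lists and matrices can be left behind.\<close>

theorem sq_minus_kernel_matrix:
  assumes zs: "distinct zs" and k: "hermitian_kernel k"
  defines "s \<equiv> sq_minus (kernel_matrix k zs)"
  shows "s \<le> length zs"
    and "\<exists>V. negative_family k (set zs) s V"
    and "\<exists>L. nonneg_on_kernel k (set zs) s L"
proof -
  let ?n = "length zs"
  let ?A = "kernel_matrix k zs"
  have A: "?A \<in> carrier_mat ?n ?n" by (simp add: kernel_matrix_def)
  have "ctranspose ?A = ?A"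
  proof (rule eq_matI)
    fix i j assume "i < dim_row ?A" "j < dim_col ?A"
    then show "ctranspose ?A $$ (i, j) = ?A $$ (i, j)"
      using k by (simp add: kernel_matrix_def hermitian_kernel_def)
  qed (auto simp: kernel_matrix_def)
  from hermitian_mat_spectral[OF A this] obtain U d
    where U: "U \<in> carrier_mat ?n ?n" "ctranspose U * U = 1\<^sub>m ?n"
    and AU: "?A = U * rdiag ?n d * ctranspose U"
    by blast
  define N where "N = {i. i < ?n \<and> d i < 0}"
  have s: "s = card N" unfolding s_def N_def by (rule sq_minus_unitary_rdiag[OF U AU])
  have finN: "finite N" by (simp add: N_def)
  have "card N \<le> card {..<?n}" by (rule card_mono) (auto simp: N_def)
  then show "s \<le> ?n" by (simp add: s)
  \<comment> \<open>Coordinate of \<open>x\<close> along eigenvector \<open>l\<close>; in these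
    coordinates the form is a sum of squares with weights \<open>d l\<close>.\<close>
  define coord where "coord = (\<lambda>x l. \<Sum>i<?n. cnj (U $$ (i, l)) * x (zs ! i))"
  have entry: "k (zs ! i) (zs ! j) = (\<Sum>l<?n. U $$ (i, l) * complex_of_real (d l) * cnj (U $$ (j, l)))"
    if "i < ?n" "j < ?n" for i j
  proof -
    have UD: "(U * rdiag ?n d) $$ (i, l) = U $$ (i, l) * complex_of_real (d l)" if "l < ?n" for l
      using U(1) \<open>i < ?n\<close> that
      by (simp add: scalar_prod_def rdiag_def atLeast0LessThan if_distrib sum.delta cong: if_cong)
    have "k (zs ! i) (zs ! j) = ?A $$ (i, j)" using that by (simp add: kernel_matrix_def)
    also have "\<dots> = (\<Sum>l<?n. (U * rdiag ?n d) $$ (i, l) * cnj (U $$ (j, l)))"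
      unfolding AU using U(1) that by (simp add: scalar_prod_def atLeast0LessThan rdiag_def)
    also have "\<dots> = (\<Sum>l<?n. U $$ (i, l) * complex_of_real (d l) * cnj (U $$ (j, l)))"
      by (rule sum.cong) (auto simp: UD)
    finally show ?thesis .
  qed
  have form: "Re (hform k (set zs) x) = (\<Sum>l<?n. d l * (cmod (coord x l))\<^sup>2)" for x
  proof -
    have "hform k (set zs) x = (\<Sum>i<?n. \<Sum>j<?n. \<Sum>l<?n.
        complex_of_real (d l) * ((cnj (x (zs ! i)) * U $$ (i, l)) * (cnj (U $$ (j, l)) * x (zs ! j))))"
      unfolding hform_set[OF zs]
      by (intro sum.cong refl) (simp add: entry sum_distrib_left sum_distrib_right mult_ac)
    also have "\<dots> = (\<Sum>l<?n. \<Sum>i<?n. \<Sum>j<?n.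
        complex_of_real (d l) * ((cnj (x (zs ! i)) * U $$ (i, l)) * (cnj (U $$ (j, l)) * x (zs ! j))))"
      by (subst (2) sum.swap, subst sum.swap) (rule refl)
    also have "\<dots> = (\<Sum>l<?n. complex_of_real (d l) * (cnj (coord x l) * coord x l))"
      by (intro sum.cong refl)
        (simp add: coord_def sum_product sum_distrib_left mult.commute mult.left_commute)
    also have "\<dots> = complex_of_real (\<Sum>l<?n. d l * (cmod (coord x l))\<^sup>2)"
      unfolding of_real_sum of_real_mult complex_norm_square by (simp add: mult.commute)
    finally show ?thesis by simp
  qed
  \<comment> \<open>\<open>e\<close> numbers the negative eigenvalues, so that the family is indexed
    by \<open>{..<s}\<close>.\<close>
  obtain e where e: "bij_betw e {..<s} N"
    using ex_bij_betw_nat_finite[OF finN] by (auto simp: s atLeast0LessThan)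
  have "\<exists>x. \<forall>i<?n. x (zs ! i) = U $$ (i, e j)" for j
    using obtain_on_distinct_list[OF zs, of "\<lambda>i. U $$ (i, e j)"] by metis
  then obtain V where V: "\<And>j i. i < ?n \<Longrightarrow> V j (zs ! i) = U $$ (i, e j)" by metis
  have orth: "(\<Sum>i<?n. cnj (U $$ (i, l)) * U $$ (i, m)) = (if l = m then 1 else 0)"
    if "l < ?n" "m < ?n" for l m
    using arg_cong[OF U(2), of "\<lambda>M. M $$ (l, m)"] U(1) that
    by (simp add: scalar_prod_def atLeast0LessThan)
  have eN: "e j < ?n" "d (e j) < 0" if "j < s" for j
    using bij_betwE[OF e] that by (auto simp: N_def)
  have coordV: "coord (\<lambda>z. \<Sum>j<s. c j * V j z) l = (\<Sum>j<s. if e j = l then c j else 0)" if "l < ?n" for c l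
  proof -
    have "coord (\<lambda>z. \<Sum>j<s. c j * V j z) l = (\<Sum>j<s. c j * (\<Sum>i<?n. cnj (U $$ (i, l)) * U $$ (i, e j)))"
      unfolding coord_def sum_distrib_left
      by (subst sum.swap) (intro sum.cong refl, simp add: V mult_ac)
    also have "\<dots> = (\<Sum>j<s. if e j = l then c j else 0)"
      using that eN by (intro sum.cong refl) (auto simp: orth)
    finally show ?thesis .
  qed
  have "negative_family k (set zs) s V"
    unfolding negative_family_def
  proof (intro allI impI)
    fix c :: "nat \<Rightarrow> complex" assume "\<exists>i<s. c i \<noteq> 0"
    then obtain i where i: "i < s" "c i \<noteq> 0" by blast
    let ?x = "\<lambda>z. \<Sum>j<s. c j * V j z"
    have ci: "coord ?x (e i) = c i"
    proof -
      have "e j = e i \<longleftrightarrow> j = i" if "j < s" for j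
        using bij_betw_imp_inj_on[OF e] that i by (auto simp: inj_on_def)
      then have "(\<Sum>j<s. if e j = e i then c j else 0) = (\<Sum>j<s. if j = i then c j else 0)"
        by (intro sum.cong) auto
      then show ?thesis using coordV eN(1) i by simp
    qed
    \<comment> \<open>Outside \<open>N\<close> the combination has no coordinate, so no positive
      eigenvalue contributes.\<close>
    have nonpos: "d l * (cmod (coord ?x l))\<^sup>2 \<le> 0" if "l < ?n" for l
    proof (cases "l \<in> N")
      case True
      then show ?thesis by (simp add: N_def mult_nonpos_nonneg)
    next
      case False
      then have "e j \<noteq> l" if "j < s" for j using bij_betwE[OF e] that by auto
      then show ?thesis using coordV[OF that, of c] by simp
    qed
    have "(\<Sum>l<?n. d l * (cmod (coord ?x l))\<^sup>2)
        = d (e i) * (cmod (c i))\<^sup>2 + (\<Sum>l\<in>{..<?n} - {e i}. d l * (cmod (coord ?x l))\<^sup>2)"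
      using eN(1) i ci by (subst sum.remove[of _ "e i"]) auto
    also have "\<dots> < 0"
      using eN(2) i nonpos by (intro add_neg_nonpos sum_nonpos mult_neg_pos) auto
    finally show "Re (hform k (set zs) ?x) < 0" by (simp add: form)
  qed
  then show "\<exists>V. negative_family k (set zs) s V" by blast
  have "\<exists>x. \<forall>i<?n. x (zs ! i) = cnj (U $$ (i, e j))" for j
    using obtain_on_distinct_list[OF zs, of "\<lambda>i. cnj (U $$ (i, e j))"] by metis
  then obtain L where L: "\<And>j i. i < ?n \<Longrightarrow> L j (zs ! i) = cnj (U $$ (i, e j))" by metis
  have "nonneg_on_kernel k (set zs) s L"
    unfolding nonneg_on_kernel_def
  proof (intro allI impI)
    fix x :: "'a \<Rightarrow> complex" assume x: "\<forall>i<s. (\<Sum>z\<in>set zs. L i z * x z) = 0"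
    have 0: "coord x l = 0" if l: "l \<in> N" for l
    proof -
      obtain j where j: "j < s" "l = e j" using e l by (auto simp: bij_betw_def)
      have "coord x l = (\<Sum>i<?n. L j (zs ! i) * x (zs ! i))"
        by (simp add: coord_def L j)
      then show ?thesis using x j sum_nth_distinct[OF zs, of "\<lambda>z. L j z * x z"] by simp
    qed
    have "0 \<le> d l * (cmod (coord x l))\<^sup>2" if "l < ?n" for l
      using 0[of l] that by (cases "l \<in> N") (auto simp: N_def)
    then show "0 \<le> Re (hform k (set zs) x)" unfolding form by (intro sum_nonneg) auto
  qed
  then show "\<exists>L. nonneg_on_kernel k (set zs) s L" by blast
qed

section \<open>Positivity of the Pick kernel of a Schur function\<close>

definition pick_kernel :: "(complex \<Rightarrow> complex) \<Rightarrow> complex \<Rightarrow> complex \<Rightarrow> complex" where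
  "pick_kernel f z w = (1 - f z * cnj (f w)) / (1 - z * cnj w)"

lemma hermitian_pick_kernel: "hermitian_kernel (pick_kernel f)"
  by (simp add: hermitian_kernel_def pick_kernel_def mult.commute)

lemma unit_disc_denominator:
  assumes "cmod z < 1" "cmod w < 1"
  shows "1 - z * cnj w \<noteq> 0"
proof
  assume "1 - z * cnj w = 0"
  then have "cmod (z * cnj w) = 1" by simp
  moreover have "cmod z * cmod w < 1 * 1"
    using assms by (intro mult_strict_mono') auto
  ultimately show False by (simp add: norm_mult)
qed

section \<open>Algebra of Hermitian forms\<close>

lemma hform_real:
  assumes "hermitian_kernel k"
  shows "Im (hform k Z x) = 0"
proof -
  have "cnj (hform k Z x) = (\<Sum>z\<in>Z. \<Sum>w\<in>Z. cnj (x w) * k w z * x z)"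
    using assms unfolding hform_def cnj_sum
    by (intro sum.cong refl) (simp add: hermitian_kernel_def mult_ac)
  also have "\<dots> = hform k Z x" unfolding hform_def by (rule sum.swap)
  finally show ?thesis by (simp add: complex_eq_iff)
qed

lemma hform_rank_one:
  "hform (\<lambda>z w. u z * cnj (u w)) Z x = complex_of_real ((cmod (\<Sum>z\<in>Z. cnj (u z) * x z))\<^sup>2)"
  unfolding hform_def complex_norm_square cnj_sum sum_product
  by (subst sum.swap) (intro sum.cong refl, simp add: mult_ac)

lemma hform_scaled:
  "hform (\<lambda>z w. v z * cnj (v w) * k z w) Z x = hform k Z (\<lambda>z. cnj (v z) * x z)"
  unfolding hform_def by (intro sum.cong refl) (simp add: mult_ac)

lemma hform_combination:
  assumes "\<And>z w. z \<in> Z \<Longrightarrow> w \<in> Z \<Longrightarrow> k z w = complex_of_real c * k1 z w + complex_of_real e * k2 z w"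
  shows "hform k Z x = complex_of_real c * hform k1 Z x + complex_of_real e * hform k2 Z x"
proof -
  have "hform k Z x = (\<Sum>z\<in>Z. \<Sum>w\<in>Z. complex_of_real c * (cnj (x z) * k1 z w * x w)
      + complex_of_real e * (cnj (x z) * k2 z w * x w))"
    unfolding hform_def by (intro sum.cong refl) (simp add: assms algebra_simps)
  then show ?thesis
    unfolding hform_def by (simp add: sum.distrib sum_distrib_left)
qed

lemma hform_subset:
  assumes "finite Z'" "Z \<subseteq> Z'" "\<And>z. z \<in> Z' - Z \<Longrightarrow> x z = 0"
  shows "hform k Z' x = hform k Z x"
proof -
  have "(\<Sum>w\<in>Z'. cnj (x z) * k z w * x w) = (\<Sum>w\<in>Z. cnj (x z) * k z w * x w)" for z
    using assms by (intro sum.mono_neutral_right) auto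
  then have "hform k Z' x = (\<Sum>z\<in>Z'. \<Sum>w\<in>Z. cnj (x z) * k z w * x w)"
    by (simp add: hform_def)
  also have "\<dots> = hform k Z x"
    unfolding hform_def using assms by (intro sum.mono_neutral_right) auto
  finally show ?thesis .
qed

section \<open>The Schwarz lemma and the Schur transform\<close>

lemma schur_function_unimodular_value_constant:
  assumes "schur_function S" "cmod a < 1" "cmod (S a) = 1"
  shows "\<exists>c. cmod c = 1 \<and> (\<forall>z\<in>ball 0 1. S z = c)"
proof -
  have "S constant_on ball 0 1"
  \<comment> \<open>Maximum modulus principle at \<open>a\<close>; \<open>1 - cmod a\<close> is the
    radius of the largest disc about \<open>a\<close> inside the unit disc.\<close>
  proof (rule Schwarz2[where w = a and s = "1 - cmod a"])
    show "ball a (1 - cmod a) \<subseteq> ball 0 1"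
    proof
      fix z assume "z \<in> ball a (1 - cmod a)"
      then show "z \<in> ball 0 1"
        using norm_triangle_sub[of z a] by (simp add: dist_norm norm_minus_commute)
    qed
    then show "cmod (S z) \<le> cmod (S a)" if "cmod (a - z) < 1 - cmod a" for z
      using assms that by (auto simp: schur_function_def dist_norm)
  qed (use assms in \<open>auto simp: schur_function_def\<close>)
  then show ?thesis using assms by (force simp: constant_on_def)
qed

text \<open>Disc automorphisms move \<open>a\<close> and \<open>S a\<close> to \<open>0\<close>, and
  the Schwarz lemma divides the resulting function by its argument. The equation is free of
  quotients because the one defining \<open>T\<close> has a removable singularity at
  \<open>z = a\<close>.\<close>

lemma schur_transform_exists:
  assumes S: "S holomorphic_on ball 0 1" "\<And>z. cmod z < 1 \<Longrightarrow> cmod (S z) < 1" and a: "cmod a < 1"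
  shows "\<exists>T. schur_function T \<and>
    (\<forall>z\<in>ball 0 1. T z * ((z - a) * (1 - cnj (S a) * S z)) = (S z - S a) * (1 - cnj a * z))"
proof -
  define b where "b = Moebius_function 0 a"
  define b' where "b' = Moebius_function 0 (- a)"
  define B where "B = Moebius_function 0 (S a)"
  define F where "F = B \<circ> (S \<circ> b')"
  have hol: "b holomorphic_on ball 0 1" "b' holomorphic_on ball 0 1" "B holomorphic_on ball 0 1"
    using a S(2)[OF a] by (auto simp: b_def b'_def B_def intro!: Moebius_function_holomorphic)
  have lt1: "cmod (b z) < 1" "cmod (b' z) < 1" "cmod (B z) < 1" if "cmod z < 1" for z
    using a S(2)[OF a] that by (auto simp: b_def b'_def B_def intro!: Moebius_function_norm_lt_1)
  have "S \<circ> b' holomorphic_on ball 0 1"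
    by (rule holomorphic_on_compose_gen[OF hol(2) S(1)]) (auto simp: lt1)
  then have F: "F holomorphic_on ball 0 1"
    unfolding F_def by (rule holomorphic_on_compose_gen[OF _ hol(3)]) (auto simp: lt1 S(2))
  have F0: "F 0 = 0"
    by (simp add: F_def b'_def B_def Moebius_function_simple)
  have Flt: "cmod (F z) < 1" if "cmod z < 1" for z
    using that by (simp add: F_def lt1 S(2))
  obtain h where h: "h holomorphic_on ball 0 1" "\<And>z. cmod z < 1 \<Longrightarrow> F z = z * h z" "deriv F 0 = h 0"
    using Schwarz3[OF F F0] by blast
  \<comment> \<open>At the origin the quotient is the derivative, so the derivative bound of the
    Schwarz lemma covers the point where division fails.\<close>
  have h1: "cmod (h z) \<le> 1" if "cmod z < 1" for z
  proof (cases "z = 0")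
    case True
    then show ?thesis using Schwarz_Lemma(2)[OF F F0 Flt that] h(3) by simp
  next
    case False
    have "cmod z * cmod (h z) \<le> cmod z * 1"
      using Schwarz_Lemma(1)[OF F F0 Flt that] h(2)[OF that] by (simp add: norm_mult)
    then show ?thesis using False by simp
  qed
  have "h \<circ> b holomorphic_on ball 0 1"
    by (rule holomorphic_on_compose_gen[OF hol(1) h(1)]) (auto simp: lt1)
  then have "schur_function (h \<circ> b)"
    by (simp add: schur_function_def h1 lt1)
  moreover have "(h \<circ> b) z * ((z - a) * (1 - cnj (S a) * S z)) = (S z - S a) * (1 - cnj a * z)"
    if "z \<in> ball 0 1" for z
  proof -
    have z: "cmod z < 1" using that by simp
    have d: "1 - cnj a * z \<noteq> 0" "1 - cnj (S a) * S z \<noteq> 0"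
      using unit_disc_denominator[OF z a] unit_disc_denominator[OF S(2)[OF z] S(2)[OF a]]
      by (auto simp: mult.commute)
    have "b' (b z) = z"
      unfolding b_def b'_def by (rule Moebius_function_compose) (use a z in auto)
    then have "B (S z) = b z * h (b z)"
      using h(2)[OF lt1(1)[OF z]] by (simp add: F_def)
    then have "(S z - S a) / (1 - cnj (S a) * S z) = (z - a) / (1 - cnj a * z) * h (b z)"
      by (simp add: b_def B_def Moebius_function_simple)
    then show ?thesis using d by (simp add: field_simps)
  qed
  ultimately show ?thesis by blast
qed

text \<open>One step of the Schur algorithm splits off a rank-one positive term; what remains is a rescaled
  Pick form of the Schur transform \<open>T\<close>, with weight vanishing at the point \<open>a\<close>.\<close>

theorem schur_function_pick_form_nonneg:
  assumes "schur_function S" "finite Z" "Z \<subseteq> ball 0 1"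
  shows "Re (hform (pick_kernel S) Z x) \<ge> 0"
  using assms(2,3,1)
proof (induction Z arbitrary: S x rule: finite_induct)
  case empty
  then show ?case by (simp add: hform_def)
next
  case (insert a Z)
  have a: "cmod a < 1" using insert.prems by auto
  show ?case
  proof (cases "\<exists>z. cmod z < 1 \<and> cmod (S z) = 1")
    case True
    \<comment> \<open>A unimodular value makes \<open>S\<close> constant and its Pick kernel zero.
      Otherwise \<open>|S| < 1\<close> on the disc, as the Schur transform requires.\<close>
    then obtain c where c: "cmod c = 1" "\<forall>z\<in>ball 0 1. S z = c"
      using schur_function_unimodular_value_constant insert.prems(2) by blast
    have "c * cnj c = 1"
      using c(1) by (simp add: complex_norm_square[symmetric])
    have 0: "pick_kernel S z w = 0" if "z \<in> insert a Z" "w \<in> insert a Z" for z w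
    proof -
      have "S z = c" "S w = c" using c(2) that insert.prems(1) by blast+
      then show ?thesis using \<open>c * cnj c = 1\<close> by (simp add: pick_kernel_def)
    qed
    have "hform (pick_kernel S) (insert a Z) x = 0"
      unfolding hform_def by (rule sum.neutral, rule ballI, rule sum.neutral) (simp add: 0)
    then show ?thesis by simp
  next
    case False
    have S1: "cmod (S z) < 1" if "cmod z < 1" for z
    proof -
      have "cmod (S z) \<le> 1" using insert.prems(2) that by (simp add: schur_function_def)
      moreover have "cmod (S z) \<noteq> 1" using False that by blast
      ultimately show ?thesis by simp
    qed
    obtain T where T: "schur_function T"
      "\<And>z. z \<in> ball 0 1 \<Longrightarrow> T z * ((z - a) * (1 - cnj (S a) * S z)) = (S z - S a) * (1 - cnj a * z)"
      using schur_transform_exists[of S a] S1 a insert.prems(2) unfolding schur_function_def by blast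
    define A where "A = 1 - (cmod (S a))\<^sup>2"
    have A: "A > 0" "complex_of_real A = 1 - S a * cnj (S a)"
      using S1[OF a] complex_norm_square[of "S a"] by (simp_all add: A_def abs_square_less_1)
    have C: "complex_of_real (1 - (cmod a)\<^sup>2) = 1 - a * cnj a" "1 - (cmod a)\<^sup>2 > 0"
      using a complex_norm_square[of a] by (simp_all add: abs_square_less_1)
    \<comment> \<open>The weights come from (1 - |s|^2)(1 - x cnj y) = (1 - cnj s x)(1 - s cnj y) -
      (x - s)(cnj y - cnj s), used for the values with \<open>s = S a\<close> and for the points
      with \<open>s = a\<close>.\<close>
    define u where "u = (\<lambda>z. (1 - cnj (S a) * S z) / (1 - cnj a * z))"
    define v where "v = (\<lambda>z. (z - a) * u z)"
    have dec: "pick_kernel S z w = complex_of_real ((1 - (cmod a)\<^sup>2) / A) * (u z * cnj (u w))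
        + complex_of_real (1 / A) * (v z * cnj (v w) * pick_kernel T z w)"
      if "z \<in> insert a Z" "w \<in> insert a Z" for z w
    proof -
      have zw: "cmod z < 1" "cmod w < 1" using that insert.prems(1) by auto
      let ?r = "1 - z * cnj w"
      have r: "?r \<noteq> 0" using unit_disc_denominator[OF zw] .
      have d: "1 - cnj a * z \<noteq> 0" if "cmod z < 1" for z
        using unit_disc_denominator[OF that a] by (simp add: mult.commute)
      have u: "u z * (1 - cnj a * z) = 1 - cnj (S a) * S z" if "cmod z < 1" for z
        using d[OF that] by (simp add: u_def)
      have vT: "v z * T z = S z - S a" if "cmod z < 1" for z
      proof -
        have "v z * T z * (1 - cnj a * z) = T z * ((z - a) * (u z * (1 - cnj a * z)))"
          by (simp only: v_def mult_ac)
        also have "\<dots> = (S z - S a) * (1 - cnj a * z)"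
          unfolding u[OF that] using T(2)[of z] that by simp
        finally have "v z * T z * (1 - cnj a * z) = (S z - S a) * (1 - cnj a * z)" .
        then show ?thesis using d[OF that] by simp
      qed
      have cu: "cnj (u w) * (1 - a * cnj w) = 1 - S a * cnj (S w)"
        using arg_cong[OF u[OF zw(2)], of cnj] by simp
      have cv: "cnj (v w) * cnj (T w) = cnj (S w) - cnj (S a)"
        using arg_cong[OF vT[OF zw(2)], of cnj] by simp
      have "(1 - S a * cnj (S a)) * (1 - S z * cnj (S w))
          = (1 - cnj (S a) * S z) * (1 - S a * cnj (S w)) - (S z - S a) * (cnj (S w) - cnj (S a))"
        by (simp add: algebra_simps)
      also have "\<dots> = (u z * (1 - cnj a * z)) * (cnj (u w) * (1 - a * cnj w))
          - (v z * T z) * (cnj (v w) * cnj (T w))"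
        unfolding u[OF zw(1)] cu vT[OF zw(1)] cv ..
      also have "\<dots> = (1 - a * cnj a) * (u z * cnj (u w)) * ?r
          + v z * cnj (v w) * (1 - T z * cnj (T w))"
        unfolding v_def by (simp add: algebra_simps)
      finally have main: "complex_of_real A * (1 - S z * cnj (S w)) =
          complex_of_real (1 - (cmod a)\<^sup>2) * (u z * cnj (u w)) * ?r + v z * cnj (v w) * (1 - T z * cnj (T w))"
        unfolding A(2) C(1) .
      have "complex_of_real A * pick_kernel S z w = complex_of_real A * (1 - S z * cnj (S w)) / ?r"
        by (simp add: pick_kernel_def)
      also have "\<dots> = complex_of_real (1 - (cmod a)\<^sup>2) * (u z * cnj (u w))
          + v z * cnj (v w) * pick_kernel T z w"
        unfolding main pick_kernel_def using r by (simp add: add_divide_distrib)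
      finally have "pick_kernel S z w = (complex_of_real (1 - (cmod a)\<^sup>2) * (u z * cnj (u w))
          + v z * cnj (v w) * pick_kernel T z w) / complex_of_real A"
        using A(1) by (simp add: eq_divide_eq mult.commute)
      then show ?thesis by (simp add: add_divide_distrib)
    qed
    \<comment> \<open>Since \<open>v a = 0\<close>, the point \<open>a\<close> drops out of the form
      of \<open>T\<close>, and the induction hypothesis for \<open>Z\<close>, generalised over the
      Schur function, applies to \<open>T\<close>.\<close>
    have "hform (pick_kernel T) (insert a Z) (\<lambda>z. cnj (v z) * x z)
        = hform (pick_kernel T) Z (\<lambda>z. cnj (v z) * x z)"
      by (rule hform_subset) (use insert.hyps in \<open>auto simp: v_def\<close>)
    moreover have "Re (hform (pick_kernel T) Z (\<lambda>z. cnj (v z) * x z)) \<ge> 0"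
      using insert.IH insert.prems(1) T(1) by simp
    moreover have "hform (pick_kernel S) (insert a Z) x
        = complex_of_real ((1 - (cmod a)\<^sup>2) / A) * hform (\<lambda>z w. u z * cnj (u w)) (insert a Z) x
          + complex_of_real (1 / A) * hform (\<lambda>z w. v z * cnj (v w) * pick_kernel T z w) (insert a Z) x"
      by (rule hform_combination) (rule dec)
    ultimately show ?thesis
      unfolding hform_rank_one hform_scaled using A(1) C(2) by simp
  qed
qed

section \<open>Schur complements of Pick matrices\<close>

text \<open>When the form on \<open>Z\<close> is nonsingular, row \<open>T z\<close> is k(z, Z)
  times the inverse of its matrix. Recording the equations for this product avoids inverse matrices
  and an ordering of \<open>Z\<close>.\<close>

locale schur_complement =
  fixes k :: "'a \<Rightarrow> 'a \<Rightarrow> complex" and Z :: "'a set" and T :: "'a \<Rightarrow> 'a \<Rightarrow> complex"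
  assumes hermitian: "hermitian_kernel k" and finite_Z: "finite Z"
    and T: "\<And>z l. l \<in> Z \<Longrightarrow> (\<Sum>j\<in>Z. T z j * k j l) = k z l"
begin

definition complement :: "'a \<Rightarrow> 'a \<Rightarrow> complex" where
  "complement z w = k z w - (\<Sum>j\<in>Z. T z j * k j w)"

lemma T_cnj:
  assumes "j \<in> Z"
  shows "(\<Sum>l\<in>Z. k j l * cnj (T w l)) = k j w"
  using arg_cong[OF T[OF assms, of w], of cnj] hermitian
  by (simp add: hermitian_kernel_def mult.commute)

lemma complement_eq:
  "complement z w = k z w - (\<Sum>j\<in>Z. \<Sum>l\<in>Z. T z j * k j l * cnj (T w l))"
proof -
  have "(\<Sum>j\<in>Z. T z j * k j w) = (\<Sum>j\<in>Z. T z j * (\<Sum>l\<in>Z. k j l * cnj (T w l)))"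
    by (intro sum.cong refl) (simp add: T_cnj)
  then show ?thesis by (simp add: complement_def sum_distrib_left mult.assoc)
qed

text \<open>Completing the square: shifting the \<open>Z\<close>-part by \<open>t\<close> absorbs
  the mixed terms (\<open>right\<close> and \<open>left\<close>), and the excess
  \<open>hform k Z t\<close> is what the complement subtracts from \<open>k\<close> on
  \<open>W\<close>.\<close>

lemma hform_complement:
  assumes W: "finite W" "Z \<inter> W = {}"
  shows "hform k (Z \<union> W) y =
    hform k Z (\<lambda>l. y l + (\<Sum>w\<in>W. cnj (T w l) * y w)) + hform complement W y"
proof -
  define t where "t = (\<lambda>l. \<Sum>w\<in>W. cnj (T w l) * y w)"
  have right: "(\<Sum>l\<in>Z. k j l * t l) = (\<Sum>w\<in>W. k j w * y w)" if "j \<in> Z" for j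
  proof -
    have "(\<Sum>l\<in>Z. k j l * t l) = (\<Sum>w\<in>W. (\<Sum>l\<in>Z. k j l * cnj (T w l)) * y w)"
      unfolding t_def sum_distrib_left sum_distrib_right mult.assoc by (rule sum.swap)
    then show ?thesis using that by (simp add: T_cnj)
  qed
  have left: "(\<Sum>j\<in>Z. cnj (t j) * k j l) = (\<Sum>w\<in>W. cnj (y w) * k w l)" if "l \<in> Z" for l
  proof -
    have "(\<Sum>j\<in>Z. cnj (t j) * k j l) = (\<Sum>w\<in>W. cnj (y w) * (\<Sum>j\<in>Z. T w j * k j l))"
      unfolding t_def cnj_sum sum_distrib_left sum_distrib_right
      by (subst sum.swap) (simp add: mult_ac)
    then show ?thesis using that by (simp add: T)
  qed
  have ZW: "(\<Sum>z\<in>Z. \<Sum>w\<in>W. cnj (y z) * k z w * y w) = (\<Sum>z\<in>Z. \<Sum>l\<in>Z. cnj (y z) * k z l * t l)"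
    by (rule sum.cong[OF refl]) (simp add: mult.assoc sum_distrib_left[symmetric] right)
  have WZ: "(\<Sum>z\<in>W. \<Sum>w\<in>Z. cnj (y z) * k z w * y w) = (\<Sum>z\<in>Z. \<Sum>l\<in>Z. cnj (t z) * k z l * y l)"
    by (subst sum.swap, subst (2) sum.swap)
      (rule sum.cong[OF refl], simp add: sum_distrib_right[symmetric] left)
  have WW: "hform k Z t = (\<Sum>z\<in>W. \<Sum>w\<in>W. cnj (y z) * (\<Sum>j\<in>Z. T z j * k j w) * y w)"
  proof -
    have "hform k Z t = (\<Sum>j\<in>Z. \<Sum>w\<in>W. cnj (t j) * k j w * y w)"
      unfolding hform_def
      by (rule sum.cong[OF refl]) (simp add: mult.assoc sum_distrib_left[symmetric] right)
    also have "\<dots> = (\<Sum>w\<in>W. (\<Sum>j\<in>Z. cnj (t j) * k j w) * y w)"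
      by (subst sum.swap) (simp add: sum_distrib_right)
    also have "\<dots> = (\<Sum>w\<in>W. (\<Sum>z\<in>W. cnj (y z) * (\<Sum>j\<in>Z. T z j * k j w)) * y w)"
      unfolding t_def cnj_sum sum_distrib_left sum_distrib_right
      by (rule sum.cong[OF refl], subst sum.swap) (simp add: mult_ac)
    also have "\<dots> = (\<Sum>z\<in>W. \<Sum>w\<in>W. cnj (y z) * (\<Sum>j\<in>Z. T z j * k j w) * y w)"
      unfolding sum_distrib_right by (rule sum.swap)
    finally show ?thesis .
  qed
  have "hform k (Z \<union> W) y = hform k Z y + (\<Sum>z\<in>Z. \<Sum>w\<in>W. cnj (y z) * k z w * y w)
      + (\<Sum>z\<in>W. \<Sum>w\<in>Z. cnj (y z) * k z w * y w) + hform k W y"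
    using W finite_Z by (simp add: hform_def sum.union_disjoint sum.distrib)
  moreover have "hform k Z (\<lambda>l. y l + t l) = hform k Z y + (\<Sum>z\<in>Z. \<Sum>l\<in>Z. cnj (y z) * k z l * t l)
      + (\<Sum>z\<in>Z. \<Sum>l\<in>Z. cnj (t z) * k z l * y l) + hform k Z t"
    by (simp add: hform_def algebra_simps sum.distrib)
  moreover have "hform complement W y = hform k W y - hform k Z t"
    unfolding WW unfolding hform_def complement_def by (simp add: algebra_simps sum_subtractf)
  ultimately show ?thesis unfolding ZW WZ by (simp add: t_def)
qed

end

section \<open>Displacement structure of the Pick kernel\<close>

locale pick_complement = schur_complement "pick_kernel f" Z T
  for f :: "complex \<Rightarrow> complex" and Z :: "complex set" and T +
  assumes Z_disc: "Z \<subseteq> ball 0 1"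
    and nonsingular: "\<And>x. (\<And>l. l \<in> Z \<Longrightarrow> (\<Sum>j\<in>Z. x j * pick_kernel f j l) = 0) \<Longrightarrow> \<forall>j\<in>Z. x j = 0"
begin

text \<open>The pair \<open>(denom, - numer)\<close> is \<open>(1, - f) \<Theta>\<close>, where \<open>\<Theta>\<close> is the rational matrix function associated
  with the Pick matrix of \<open>Z\<close>, unitary on the circle for the indefinite metric \<open>diag(1, -1)\<close> and
  normalised by \<open>\<Theta>(1) = I\<close>.\<close>

definition numer :: "complex \<Rightarrow> complex" where
  "numer z = f z - (1 - z) * (\<Sum>j\<in>Z. T z j * f j / (1 - j))"

definition denom :: "complex \<Rightarrow> complex" where
  "denom z = 1 - (1 - z) * (\<Sum>j\<in>Z. T z j / (1 - j))"

lemma Z_cmod: "j \<in> Z \<Longrightarrow> cmod j < 1"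
  using Z_disc by auto

lemma one_minus_Z: "j \<in> Z \<Longrightarrow> 1 - j \<noteq> 0" "j \<in> Z \<Longrightarrow> 1 - cnj j \<noteq> 0"
proof -
  assume "j \<in> Z"
  from Z_cmod[OF this] have "j \<noteq> 1" by auto
  then show "1 - j \<noteq> 0" "1 - cnj j \<noteq> 0" by auto
qed

lemma pick_numerator:
  assumes "cmod z < 1" "cmod w < 1"
  shows "1 - f z * cnj (f w) = pick_kernel f z w * (1 - z * cnj w)"
  using unit_disc_denominator[OF assms] by (simp add: pick_kernel_def)

text \<open>Multiplied by \<open>1 - z * cnj w\<close>, the Pick kernel becomes a difference of two
  rank-one kernels. Applied to every pair among \<open>z\<close>, \<open>w\<close> and the points of
  \<open>Z\<close>, this expresses the products of \<open>denom\<close> and \<open>numer\<close>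
  through the double sum of \<open>complement_eq\<close>.\<close>

lemma complement_displacement:
  assumes z: "cmod z < 1" and w: "cmod w < 1"
  shows "complement z w * (1 - z * cnj w) = denom z * cnj (denom w) - numer z * cnj (numer w)"
proof -
  \<comment> \<open>\<open>q j l\<close> is the summand subtracted in \<open>complement_eq\<close>;
    \<open>P2\<close>, \<open>P3\<close> and \<open>P4\<close> write the combinations of \<alpha>
    and \<phi> as weighted sums of these.\<close>
  define q where "q = (\<lambda>j l. T z j * pick_kernel f j l * cnj (T w l))"
  define \<alpha> where "\<alpha> = (\<lambda>z. \<Sum>j\<in>Z. T z j / (1 - j))"
  define \<phi> where "\<phi> = (\<lambda>z. \<Sum>j\<in>Z. T z j * f j / (1 - j))"
  have P2: "\<alpha> z - \<phi> z * cnj (f w) = (\<Sum>j\<in>Z. \<Sum>l\<in>Z. q j l * ((1 - j * cnj w) / (1 - j)))"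
  proof -
    have "\<alpha> z - \<phi> z * cnj (f w) = (\<Sum>j\<in>Z. T z j * (1 - f j * cnj (f w)) / (1 - j))"
      unfolding \<alpha>_def \<phi>_def sum_distrib_right sum_subtractf[symmetric]
      by (intro sum.cong refl) (simp add: diff_divide_distrib algebra_simps)
    also have "\<dots> = (\<Sum>j\<in>Z. \<Sum>l\<in>Z. q j l * ((1 - j * cnj w) / (1 - j)))"
    proof (intro sum.cong refl)
      fix j assume j: "j \<in> Z"
      have "(\<Sum>l\<in>Z. q j l * ((1 - j * cnj w) / (1 - j)))
          = T z j * (\<Sum>l\<in>Z. pick_kernel f j l * cnj (T w l)) * ((1 - j * cnj w) / (1 - j))"
        unfolding q_def sum_distrib_left sum_distrib_right by (simp add: mult_ac)
      also have "\<dots> = T z j * (pick_kernel f j w * (1 - j * cnj w)) / (1 - j)"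
        by (simp add: T_cnj[OF j])
      finally show "T z j * (1 - f j * cnj (f w)) / (1 - j) = (\<Sum>l\<in>Z. q j l * ((1 - j * cnj w) / (1 - j)))"
        unfolding pick_numerator[OF Z_cmod[OF j] w] by simp
    qed
    finally show ?thesis .
  qed
  have P3: "cnj (\<alpha> w) - f z * cnj (\<phi> w) = (\<Sum>j\<in>Z. \<Sum>l\<in>Z. q j l * ((1 - z * cnj l) / (1 - cnj l)))"
  proof -
    have "cnj (\<alpha> w) - f z * cnj (\<phi> w) = (\<Sum>l\<in>Z. cnj (T w l) * (1 - f z * cnj (f l)) / (1 - cnj l))"
      unfolding \<alpha>_def \<phi>_def cnj_sum sum_distrib_left sum_subtractf[symmetric]
      by (intro sum.cong refl) (simp add: diff_divide_distrib algebra_simps)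
    also have "\<dots> = (\<Sum>l\<in>Z. \<Sum>j\<in>Z. q j l * ((1 - z * cnj l) / (1 - cnj l)))"
    proof (intro sum.cong refl)
      fix l assume l: "l \<in> Z"
      have "(\<Sum>j\<in>Z. q j l * ((1 - z * cnj l) / (1 - cnj l)))
          = cnj (T w l) * (\<Sum>j\<in>Z. T z j * pick_kernel f j l) * ((1 - z * cnj l) / (1 - cnj l))"
        unfolding q_def sum_distrib_left sum_distrib_right by (simp add: mult_ac)
      also have "\<dots> = cnj (T w l) * (pick_kernel f z l * (1 - z * cnj l)) / (1 - cnj l)"
        by (simp add: T[OF l])
      finally show "cnj (T w l) * (1 - f z * cnj (f l)) / (1 - cnj l)
          = (\<Sum>j\<in>Z. q j l * ((1 - z * cnj l) / (1 - cnj l)))"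
        unfolding pick_numerator[OF z Z_cmod[OF l]] by simp
    qed
    also have "\<dots> = (\<Sum>j\<in>Z. \<Sum>l\<in>Z. q j l * ((1 - z * cnj l) / (1 - cnj l)))"
      by (rule sum.swap)
    finally show ?thesis .
  qed
  have P4: "\<alpha> z * cnj (\<alpha> w) - \<phi> z * cnj (\<phi> w)
      = (\<Sum>j\<in>Z. \<Sum>l\<in>Z. q j l * ((1 - j * cnj l) / ((1 - j) * (1 - cnj l))))"
  proof -
    have "\<alpha> z * cnj (\<alpha> w) - \<phi> z * cnj (\<phi> w) = (\<Sum>j\<in>Z. \<Sum>l\<in>Z.
        T z j * cnj (T w l) * (1 - f j * cnj (f l)) / ((1 - j) * (1 - cnj l)))"
      unfolding \<alpha>_def \<phi>_def cnj_sum sum_product sum_subtractf[symmetric]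
      by (intro sum.cong refl) (simp add: diff_divide_distrib algebra_simps)
    also have "\<dots> = (\<Sum>j\<in>Z. \<Sum>l\<in>Z. q j l * ((1 - j * cnj l) / ((1 - j) * (1 - cnj l))))"
      by (intro sum.cong refl) (simp add: pick_numerator[OF Z_cmod Z_cmod] q_def mult_ac)
    finally show ?thesis .
  qed
  \<comment> \<open>Term by term the three weights collapse to the single factor
    \<open>- (1 - z * cnj w)\<close>, by a polynomial identity after clearing denominators.\<close>
  have coef: "(1 - z) * (1 - cnj w) * (q j l * ((1 - j * cnj l) / ((1 - j) * (1 - cnj l))))
      - (1 - z) * (q j l * ((1 - j * cnj w) / (1 - j)))
      - (1 - cnj w) * (q j l * ((1 - z * cnj l) / (1 - cnj l)))
      = - (1 - z * cnj w) * q j l" if "j \<in> Z" "l \<in> Z" for j l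
  proof -
    have nz: "1 - j \<noteq> 0" "1 - cnj l \<noteq> 0" using one_minus_Z that by auto
    have frac: "x * y * (c * (a / (p * q))) - x * (c * (b / p)) - y * (c * (d / q))
        = c * ((x * y * a - x * b * q - y * d * p) / (p * q))"
      if "p \<noteq> 0" "q \<noteq> 0" for a b c d x y p q :: complex
      using that by (simp add: field_simps)
    have "(1 - z) * (1 - cnj w) * (1 - j * cnj l) - (1 - z) * (1 - j * cnj w) * (1 - cnj l)
        - (1 - cnj w) * (1 - z * cnj l) * (1 - j) = - (1 - z * cnj w) * ((1 - j) * (1 - cnj l))"
      by (simp add: algebra_simps)
    then show ?thesis unfolding frac[OF nz] using nz by simp
  qed
  have expand: "(1 - x * a) * (1 - y * b) - (F - x * c) * (G - y * d)
      = (1 - F * G) + (x * y * (a * b - c * d) - x * (a - c * G) - y * (b - F * d))"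
    for a b c d x y F G :: complex
    by (simp add: algebra_simps)
  have cnjs: "cnj (denom w) = 1 - (1 - cnj w) * cnj (\<alpha> w)" "cnj (numer w) = cnj (f w) - (1 - cnj w) * cnj (\<phi> w)"
    by (simp_all add: denom_def numer_def \<alpha>_def \<phi>_def)
  have "denom z * cnj (denom w) - numer z * cnj (numer w)
      = (1 - f z * cnj (f w)) + ((1 - z) * (1 - cnj w) * (\<alpha> z * cnj (\<alpha> w) - \<phi> z * cnj (\<phi> w))
        - (1 - z) * (\<alpha> z - \<phi> z * cnj (f w)) - (1 - cnj w) * (cnj (\<alpha> w) - f z * cnj (\<phi> w)))"
    unfolding cnjs expand[symmetric] by (simp add: denom_def numer_def \<alpha>_def \<phi>_def)
  also have "(1 - z) * (1 - cnj w) * (\<alpha> z * cnj (\<alpha> w) - \<phi> z * cnj (\<phi> w))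
        - (1 - z) * (\<alpha> z - \<phi> z * cnj (f w)) - (1 - cnj w) * (cnj (\<alpha> w) - f z * cnj (\<phi> w))
      = (\<Sum>j\<in>Z. \<Sum>l\<in>Z. - (1 - z * cnj w) * q j l)"
    unfolding P2 P3 P4 sum_distrib_left sum_subtractf[symmetric] by (intro sum.cong refl coef)
  also have "(1 - f z * cnj (f w)) + \<dots> = complement z w * (1 - z * cnj w)"
  proof -
    have c: "complement z w = pick_kernel f z w - (\<Sum>j\<in>Z. \<Sum>l\<in>Z. q j l)"
      by (simp add: complement_eq q_def)
    show ?thesis
      unfolding pick_numerator[OF z w] sum_distrib_left[symmetric] c by (simp add: algebra_simps)
  qed
  finally show ?thesis by simp
qed

text \<open>A common zero makes the row with entries \<open>T z j * ((z - j) / (1 - j))\<close> a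
  left null vector of the Pick matrix on \<open>Z\<close>. Nonsingularity and
  \<open>z \<notin> Z\<close> then force \<open>T z j = 0\<close> on \<open>Z\<close>, but in that
  case \<open>denom z\<close> would be \<open>1\<close>.\<close>

lemma no_common_zero:
  assumes z: "cmod z < 1" "z \<notin> Z" and zero: "denom z = 0" "numer z = 0"
  shows False
proof -
  define \<alpha> where "\<alpha> = (\<lambda>z. \<Sum>j\<in>Z. T z j / (1 - j))"
  define \<phi> where "\<phi> = (\<lambda>z. \<Sum>j\<in>Z. T z j * f j / (1 - j))"
  have eqs: "(1 - z) * \<alpha> z = 1" "(1 - z) * \<phi> z = f z"
    using zero by (simp_all add: denom_def numer_def \<alpha>_def \<phi>_def)
  have "\<forall>j\<in>Z. T z j * ((z - j) / (1 - j)) = 0"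
  proof (rule nonsingular)
    fix l assume l: "l \<in> Z"
    have l1: "1 - cnj l \<noteq> 0" using one_minus_Z l by simp
    have "(\<Sum>j\<in>Z. T z j * pick_kernel f j l) * (1 - z * cnj l) = 1 - f z * cnj (f l)"
      unfolding T[OF l] pick_numerator[OF z(1) Z_cmod[OF l]] ..
    also have "\<dots> = (1 - z) * (\<alpha> z - \<phi> z * cnj (f l))"
      unfolding right_diff_distrib mult.assoc[symmetric] eqs ..
    also have "\<alpha> z - \<phi> z * cnj (f l) = (\<Sum>j\<in>Z. T z j * (1 - f j * cnj (f l)) / (1 - j))"
      unfolding \<alpha>_def \<phi>_def sum_distrib_right sum_subtractf[symmetric]
      by (intro sum.cong refl) (simp add: diff_divide_distrib algebra_simps)
    also have "\<dots> = (\<Sum>j\<in>Z. T z j * pick_kernel f j l * (1 - j * cnj l) / (1 - j))"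
      by (intro sum.cong refl) (simp add: pick_numerator[OF Z_cmod Z_cmod] l mult_ac)
    finally have "0 = (\<Sum>j\<in>Z. T z j * pick_kernel f j l * (1 - z * cnj l)
        - (1 - z) * (T z j * pick_kernel f j l * (1 - j * cnj l) / (1 - j)))"
      by (simp add: sum_subtractf sum_distrib_left sum_distrib_right)
    also have "\<dots> = (\<Sum>j\<in>Z. T z j * ((z - j) / (1 - j)) * pick_kernel f j l * (1 - cnj l))"
    proof (intro sum.cong refl)
      fix j assume "j \<in> Z"
      then have j1: "1 - j \<noteq> 0" using one_minus_Z by simp
      have "(1 - z * cnj l) - (1 - z) * (1 - j * cnj l) / (1 - j)
          = ((1 - z * cnj l) * (1 - j) - (1 - z) * (1 - j * cnj l)) / (1 - j)"
        using j1 by (simp add: diff_divide_distrib)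
      also have "\<dots> = ((z - j) * (1 - cnj l)) / (1 - j)"
        by (rule arg_cong2[of _ _ _ _ "(/)"]) (simp_all add: algebra_simps)
      finally have e: "(1 - z * cnj l) - (1 - z) * (1 - j * cnj l) / (1 - j) = (z - j) * (1 - cnj l) / (1 - j)" .
      have pull: "t * h * x - y * (t * h * r / d) = t * h * (x - y * r / d)" for t h x y r d :: complex
        by (simp add: algebra_simps)
      show "T z j * pick_kernel f j l * (1 - z * cnj l)
          - (1 - z) * (T z j * pick_kernel f j l * (1 - j * cnj l) / (1 - j))
          = T z j * ((z - j) / (1 - j)) * pick_kernel f j l * (1 - cnj l)"
        unfolding pull e by (simp add: mult_ac)
    qed
    also have "\<dots> = (\<Sum>j\<in>Z. T z j * ((z - j) / (1 - j)) * pick_kernel f j l) * (1 - cnj l)"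
      by (simp only: sum_distrib_right)
    finally show "(\<Sum>j\<in>Z. T z j * ((z - j) / (1 - j)) * pick_kernel f j l) = 0"
      using l1 by simp
  qed
  then have "T z j = 0" if "j \<in> Z" for j
    using that z(2) one_minus_Z(1)[OF that] by auto
  then have "\<alpha> z = 0" by (simp add: \<alpha>_def)
  with eqs(1) show False by simp
qed

end

section \<open>Removing finitely many points from a Hindmarsh set\<close>

lemma nonneg_form_two_points:
  fixes p q :: real and c :: complex
  assumes "\<And>s t :: complex. 0 \<le> p * (cmod s)\<^sup>2 + 2 * Re (cnj s * c * t) + q * (cmod t)\<^sup>2"
  shows "(cmod c)\<^sup>2 \<le> p * q"
proof (cases "p > 0")
  case True
  \<comment> \<open>The test vector \<open>s = c\<close>, \<open>t = - p\<close> gives the form the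
    value p (p q - |c|^2).\<close>
  have re: "Re (cnj c * c * complex_of_real (- p)) = - p * (cmod c)\<^sup>2"
    unfolding cmod_power2 by (simp add: power2_eq_square algebra_simps)
  have "0 \<le> p * (p * q - (cmod c)\<^sup>2)"
    using assms[of c "complex_of_real (- p)"] unfolding re by (simp add: power2_eq_square algebra_simps)
  then show ?thesis using True by (simp add: zero_le_mult_iff)
next
  case False
  have q: "q \<ge> 0" using assms[of 0 1] by simp
  have p: "p = 0" using assms[of 1 0] False by simp
  define C where "C = (cmod c)\<^sup>2"
  \<comment> \<open>With \<open>p = 0\<close>, the vector \<open>(c, - t)\<close> gives the value -
    t^2 (q + 2), which forces \<open>C = 0\<close>; the denominator \<open>q + 1\<close> is positive
    even when \<open>q = 0\<close>.\<close>
  define t where "t = C / (q + 1)"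
  have re: "Re (cnj c * c * complex_of_real (- t)) = - t * C"
    unfolding C_def cmod_power2 by (simp add: power2_eq_square algebra_simps)
  have "0 \<le> q * t\<^sup>2 - 2 * t * C"
    using assms[of c "complex_of_real (- t)"] p unfolding re by simp
  also have C: "C = t * (q + 1)" using q by (simp add: t_def)
  have "q * t\<^sup>2 - 2 * t * C = - (t\<^sup>2 * (q + 2))"
    unfolding C by (simp add: power2_eq_square algebra_simps)
  finally have "t\<^sup>2 * (q + 2) \<le> 0" by simp
  then have "t = 0" using q by (simp add: mult_le_0_iff)
  then show ?thesis using C p by (simp add: C_def)
qed

text \<open>Used for points and for values alike, this converts the determinant inequality of a
  two-point Pick matrix into one between distances.\<close>

lemma cmod_diff_identity:
  "(cmod (a - b))\<^sup>2 = (cmod (1 - a * cnj b))\<^sup>2 - (1 - (cmod a)\<^sup>2) * (1 - (cmod b)\<^sup>2)"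
  unfolding cmod_power2 by (simp add: power2_eq_square algebra_simps)

lemma pick_kernel_diag:
  "pick_kernel g z z = complex_of_real ((1 - (cmod (g z))\<^sup>2) / (1 - (cmod z)\<^sup>2))"
  using complex_norm_square[of "g z"] complex_norm_square[of z] by (simp add: pick_kernel_def)

text \<open>Nonnegativity of the 2 by 2 determinant says that \<open>g\<close> contracts the
  pseudohyperbolic distance; bounding |1 - g z cnj (g w)| by 2 gives a Lipschitz-type estimate.
  Singletons \<open>W\<close> supply \<open>cmod (g v) \<le> 1\<close>.\<close>

lemma two_point_schwarz_pick:
  assumes zw: "cmod z < 1" "cmod w < 1"
    and pos: "\<And>W x. W \<subseteq> {z, w} \<Longrightarrow> Re (hform (pick_kernel g) W x) \<ge> 0"
  shows "cmod (g z - g w) \<le> 2 * cmod (z - w) / cmod (1 - z * cnj w)"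
proof -
  have le1: "cmod (g v) \<le> 1" if "v \<in> {z, w}" for v
  proof -
    have v: "(cmod v)\<^sup>2 < 1" using that zw by (auto simp: abs_square_less_1)
    have "Re (hform (pick_kernel g) {v} (\<lambda>_. 1)) \<ge> 0"
      by (rule pos) (use that in auto)
    then have "0 \<le> (1 - (cmod (g v))\<^sup>2) / (1 - (cmod v)\<^sup>2)"
      by (simp add: hform_def pick_kernel_diag)
    then have "(cmod (g v))\<^sup>2 \<le> 1" using v by (simp add: zero_le_divide_iff)
    then show ?thesis by (simp add: abs_square_le_1)
  qed
  show "cmod (g z - g w) \<le> 2 * cmod (z - w) / cmod (1 - z * cnj w)"
  proof (cases "z = w")
    case False
    define p where "p = (\<lambda>v. (1 - (cmod (g v))\<^sup>2) / (1 - (cmod v)\<^sup>2))"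
    define c where "c = pick_kernel g z w"
    have diag: "pick_kernel g v v = complex_of_real (p v)" for v
      by (simp add: pick_kernel_diag p_def)
    have c': "pick_kernel g w z = cnj c"
      using hermitian_pick_kernel[of g] by (simp add: c_def hermitian_kernel_def)
    have "(cmod c)\<^sup>2 \<le> p z * p w"
    proof (rule nonneg_form_two_points)
      fix s t :: complex
      have "0 \<le> Re (hform (pick_kernel g) {z, w} (\<lambda>v. if v = z then s else t))"
        by (rule pos) simp
      also have "hform (pick_kernel g) {z, w} (\<lambda>v. if v = z then s else t)
          = cnj s * p z * s + cnj s * c * t + (cnj t * cnj c * s + cnj t * p w * t)"
        using False by (simp add: hform_def diag c' flip: c_def)
      also have "Re \<dots> = p z * (cmod s)\<^sup>2 + 2 * Re (cnj s * c * t) + p w * (cmod t)\<^sup>2"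
        unfolding cmod_power2 by (simp add: power2_eq_square algebra_simps)
      finally show "0 \<le> p z * (cmod s)\<^sup>2 + 2 * Re (cnj s * c * t) + p w * (cmod t)\<^sup>2" .
    qed
    define N where "N = cmod (1 - g z * cnj (g w))"
    define M where "M = cmod (1 - z * cnj w)"
    define A where "A = (1 - (cmod (g z))\<^sup>2) * (1 - (cmod (g w))\<^sup>2)"
    define B where "B = (1 - (cmod z)\<^sup>2) * (1 - (cmod w)\<^sup>2)"
    have B: "B > 0" using zw by (simp add: B_def abs_square_less_1)
    have M: "M > 0" using unit_disc_denominator[OF zw] by (simp add: M_def)
    have "(N / M)\<^sup>2 \<le> A / B"
      using \<open>(cmod c)\<^sup>2 \<le> p z * p w\<close>
      by (simp add: c_def p_def pick_kernel_def norm_divide N_def M_def A_def B_def)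
    then have "(N / M)\<^sup>2 * (M\<^sup>2 * B) \<le> A / B * (M\<^sup>2 * B)"
      using B by (intro mult_right_mono) auto
    then have "N\<^sup>2 * B \<le> A * M\<^sup>2"
      using B M by (simp add: power_divide)
    moreover have id: "(cmod (g z - g w))\<^sup>2 = N\<^sup>2 - A" "(cmod (z - w))\<^sup>2 = M\<^sup>2 - B"
      using cmod_diff_identity[of "g z" "g w"] cmod_diff_identity[of z w]
      by (simp_all only: N_def M_def A_def B_def)
    ultimately have "(cmod (g z - g w))\<^sup>2 * M\<^sup>2 \<le> N\<^sup>2 * (cmod (z - w))\<^sup>2"
      unfolding id by (simp add: algebra_simps)
    then have "(cmod (g z - g w) * M)\<^sup>2 \<le> (N * cmod (z - w))\<^sup>2"
      by (simp add: power_mult_distrib)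
    then have "cmod (g z - g w) * M \<le> N * cmod (z - w)"
      by (rule power2_le_imp_le) (simp add: N_def)
    also have "N \<le> 2"
    proof -
      have "N \<le> 1 + cmod (g z) * cmod (g w)"
        unfolding N_def using norm_triangle_ineq4[of 1 "g z * cnj (g w)"] by (simp add: norm_mult)
      also have "cmod (g z) * cmod (g w) \<le> 1 * 1"
        using le1 by (intro mult_mono) auto
      finally show ?thesis by simp
    qed
    then have "N * cmod (z - w) \<le> 2 * cmod (z - w)"
      by (intro mult_right_mono) auto
    finally show ?thesis using M by (simp add: M_def pos_le_divide_eq)
  qed simp
qed

lemma psd_pick_matrixI:
  assumes zs: "distinct zs" and pos: "\<And>x. Re (hform (pick_kernel g) (set zs) x) \<ge> 0"
  shows "psd (pick_matrix g zs)"
  unfolding psd_def Let_def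
proof (intro conjI allI)
  show "pick_matrix g zs \<in> carrier_mat (dim_row (pick_matrix g zs)) (dim_row (pick_matrix g zs))"
    by (simp add: pick_matrix_def)
  fix v :: "nat \<Rightarrow> complex"
  obtain x where x: "\<And>i. i < length zs \<Longrightarrow> x (zs ! i) = v i"
    using obtain_on_distinct_list[OF zs, of v] by blast
  have "(\<Sum>i<dim_row (pick_matrix g zs). \<Sum>j<dim_row (pick_matrix g zs).
      cnj (v i) * pick_matrix g zs $$ (i, j) * v j) = hform (pick_kernel g) (set zs) x"
    unfolding hform_set[OF zs] by (simp add: pick_matrix_def pick_kernel_def x)
  then show "Im (\<Sum>i<dim_row (pick_matrix g zs). \<Sum>j<dim_row (pick_matrix g zs).
      cnj (v i) * pick_matrix g zs $$ (i, j) * v j) = 0"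
    and "0 \<le> Re (\<Sum>i<dim_row (pick_matrix g zs). \<Sum>j<dim_row (pick_matrix g zs).
      cnj (v i) * pick_matrix g zs $$ (i, j) * v j)"
    using hform_real[OF hermitian_pick_kernel] pos by simp_all
qed

text \<open>All points are moved by the same small \<open>t > 0\<close>, which keeps them distinct and takes them off \<open>Z\<close>.\<close>

lemma hindmarsh_property_punctured:
  assumes p: "p \<ge> 2" and D: "open D" "D \<subseteq> ball 0 1" "hindmarsh_property p D" and Z: "finite Z"
    and pos: "\<And>W x. W \<subseteq> D - Z \<Longrightarrow> finite W \<Longrightarrow> card W \<le> p \<Longrightarrow> Re (hform (pick_kernel g) W x) \<ge> 0"
  shows "\<exists>S. schur_function S \<and> (\<forall>z\<in>D - Z. S z = g z)"
proof -
  have lip: "cmod (g z - g w) \<le> 2 * cmod (z - w) / cmod (1 - z * cnj w)"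
    if "z \<in> D - Z" "w \<in> D - Z" for z w
  proof (rule two_point_schwarz_pick)
    fix W x assume W: "W \<subseteq> {z, w}"
    have "card W \<le> card {z, w}" using W by (intro card_mono) auto
    also have "\<dots> \<le> 2" by (simp add: card_insert_if)
    finally show "Re (hform (pick_kernel g) W x) \<ge> 0"
      using W that p finite_subset[OF W] by (intro pos) auto
  qed (use that D(2) in auto)
  \<comment> \<open>\<open>Z - {z}\<close> is finite, hence closed, and misses \<open>z\<close>, so
    small translates avoid it; \<open>t > 0\<close> separates the translate from \<open>z\<close>
    itself, which may lie in \<open>Z\<close>.\<close>
  have shift: "filterlim (\<lambda>t. z + complex_of_real t) (at z within (D - Z)) (at_right 0)" if z: "z \<in> D" for z
  proof -
    have lim: "((\<lambda>t. z + complex_of_real t) \<longlongrightarrow> z) (at_right 0)"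
      by (auto intro!: tendsto_eq_intros)
    have op: "open (D - (Z - {z}))" using D(1) Z by (simp add: open_Diff finite_imp_closed)
    have "eventually (\<lambda>t. z + complex_of_real t \<in> D - (Z - {z})) (at_right 0)"
      by (rule topological_tendstoD[OF lim op]) (use z in auto)
    moreover have "eventually (\<lambda>t. t > 0) (at_right (0 :: real))"
      by (rule eventually_at_right_less)
    ultimately have "eventually (\<lambda>t. z + complex_of_real t \<in> D - Z \<and> z + complex_of_real t \<noteq> z) (at_right 0)"
      by eventually_elim auto
    then show ?thesis using lim unfolding filterlim_at by auto
  qed
  have "\<exists>l. (g \<longlongrightarrow> l) (at z within (D - Z)) \<and> (z \<notin> Z \<longrightarrow> l = g z)" if z: "z \<in> D" for z
  proof -
    \<comment> \<open>The midpoint of \<open>cmod z\<close> and \<open>1\<close>: on the ball of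
      radius \<open>1 - s\<close> about \<open>z\<close> all moduli are at most \<open>s\<close>,
      which keeps the Schwarz-Pick denominators away from zero and makes \<open>g\<close> Lipschitz
      on \<open>X\<close>.\<close>
    define s where "s = (1 + cmod z) / 2"
    define X where "X = ball z (1 - s) \<inter> (D - Z)"
    have z1: "cmod z < 1" using z D(2) by auto
    have s: "0 < s" "s < 1" "cmod z + (1 - s) = s"
      using z1 norm_ge_zero[of z] unfolding s_def by (simp_all add: field_simps add_pos_nonneg)
    have Xs: "cmod v \<le> s" if "v \<in> X" for v
      using that norm_triangle_sub[of v z] s(3) by (simp add: X_def dist_norm norm_minus_commute)
    have lipX: "cmod (g v - g w) \<le> 2 / (1 - s * s) * cmod (v - w)" if "v \<in> X" "w \<in> X" for v w
    proof -
      have "cmod v * cmod w \<le> s * s" using Xs that s by (intro mult_mono) auto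
      then have "1 - s * s \<le> cmod (1 - v * cnj w)"
        using norm_triangle_ineq2[of 1 "v * cnj w"] by (simp add: norm_mult)
      moreover have ss: "0 < 1 - s * s" using s mult_strict_mono[of s 1 s 1] by simp
      ultimately have "2 * cmod (v - w) / cmod (1 - v * cnj w) \<le> 2 * cmod (v - w) / (1 - s * s)"
        by (intro divide_left_mono mult_pos_pos) auto
      then show ?thesis using lip[of v w] that by (auto simp: X_def)
    qed
    have "(2 / (1 - s * s))-lipschitz_on X g"
      using lipX s mult_strict_mono[of s 1 s 1] by (intro lipschitz_onI) (auto simp: dist_norm)
    then have uc: "uniformly_continuous_on X g" by (rule lipschitz_on_uniformly_continuous)
    have nhd: "at z within X = at z within (D - Z)"
      unfolding X_def by (rule at_within_nhd[of _ "ball z (1 - s)"]) (use s in auto)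
    \<comment> \<open>The translates of \<open>z\<close> approach \<open>z\<close> through
      \<open>X\<close>, also when \<open>z \<in> Z\<close>; hence \<open>z\<close> is a limit point
      and limits there are unique.\<close>
    have nontriv: "at z within X \<noteq> bot"
    proof
      assume "at z within X = bot"
      then have "filtermap (\<lambda>t. z + complex_of_real t) (at_right 0) = bot"
        using shift[OF z] unfolding nhd filterlim_def by (simp add: bot_unique)
      then show False by (simp add: filtermap_bot_iff)
    qed
    then have "z islimpt X" by (simp add: trivial_limit_within)
    then have cl: "z \<in> closure X" by (simp add: closure_def)
    obtain l where l: "(g \<longlongrightarrow> l) (at z within X)"
      by (rule uniformly_continuous_on_extension_at_closure[OF uc cl])
    have "l = g z" if "z \<notin> Z"
    proof -
      have "z \<in> X" using z s that by (simp add: X_def)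
      then have "(g \<longlongrightarrow> g z) (at z within X)"
        using uniformly_continuous_imp_continuous[OF uc] by (simp add: continuous_on_def)
      then show ?thesis using l nontriv tendsto_unique by blast
    qed
    then show ?thesis using l unfolding nhd by blast
  qed
  then obtain G where G: "\<And>z. z \<in> D \<Longrightarrow> (g \<longlongrightarrow> G z) (at z within (D - Z))"
    and Gg: "\<And>z. z \<in> D \<Longrightarrow> z \<notin> Z \<Longrightarrow> G z = g z"
    by metis
  have "psd (pick_matrix G zs)" if zs: "zs \<in> point_lists D p" for zs
  proof (rule psd_pick_matrixI)
    show "distinct zs" using zs by (simp add: point_lists_def)
    fix x
    define W where "W = set zs"
    have W: "W \<subseteq> D" "finite W" "card W = p"
      using zs by (auto simp: W_def point_lists_def distinct_card)
    \<comment> \<open>The form of \<open>g\<close> on the translated points: nonnegative for small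
      \<open>t > 0\<close>, with the form of \<open>G\<close> on \<open>W\<close> as its
      limit.\<close>
    let ?F = "\<lambda>t. \<Sum>z\<in>W. \<Sum>w\<in>W. cnj (x z) * pick_kernel g (z + complex_of_real t) (w + complex_of_real t) * x w"
    have gt: "((\<lambda>t. g (z + complex_of_real t)) \<longlongrightarrow> G z) (at_right 0)" if "z \<in> W" for z
    proof -
      have "z \<in> D" using that W(1) by auto
      show ?thesis by (rule filterlim_compose[OF G[OF \<open>z \<in> D\<close>] shift[OF \<open>z \<in> D\<close>]])
    qed
    have "(?F \<longlongrightarrow> (\<Sum>z\<in>W. \<Sum>w\<in>W. cnj (x z) * pick_kernel G z w * x w)) (at_right 0)"
    proof (intro tendsto_sum tendsto_mult tendsto_const)
      fix z w assume zw: "z \<in> W" "w \<in> W"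
      have "1 - z * cnj w \<noteq> 0"
        using unit_disc_denominator[of z w] zw W(1) D(2) by (auto simp: subset_iff)
      then have "((\<lambda>t. (1 - g (z + complex_of_real t) * cnj (g (w + complex_of_real t))) /
          (1 - (z + complex_of_real t) * cnj (w + complex_of_real t))) \<longlongrightarrow>
          (1 - G z * cnj (G w)) / (1 - (z + complex_of_real 0) * cnj (w + complex_of_real 0))) (at_right 0)"
        using gt zw by (intro tendsto_intros) auto
      then show "((\<lambda>t. pick_kernel g (z + complex_of_real t) (w + complex_of_real t)) \<longlongrightarrow> pick_kernel G z w) (at_right 0)"
        by (simp add: pick_kernel_def)
    qed
    then have lim: "((\<lambda>t. Re (?F t)) \<longlongrightarrow> Re (hform (pick_kernel G) W x)) (at_right 0)"
      unfolding hform_def by (rule tendsto_Re)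
    have "eventually (\<lambda>t. z + complex_of_real t \<in> D - Z) (at_right 0)" if "z \<in> W" for z
    proof -
      have "z \<in> D" using that W(1) by auto
      from shift[OF this]
      have "eventually (\<lambda>t. z + complex_of_real t \<in> D - Z \<and> z + complex_of_real t \<noteq> z) (at_right 0)"
        unfolding filterlim_at by (rule conjunct1)
      then show ?thesis by (rule eventually_mono) simp
    qed
    then have "eventually (\<lambda>t. \<forall>z\<in>W. z + complex_of_real t \<in> D - Z) (at_right 0)"
      using W(2) by (simp add: eventually_ball_finite_distrib)
    then have ev: "eventually (\<lambda>t. 0 \<le> Re (?F t)) (at_right 0)"
    proof (rule eventually_mono)
      fix t assume elim: "\<forall>z\<in>W. z + complex_of_real t \<in> D - Z"
      let ?h = "\<lambda>z. z + complex_of_real t"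
      have inj: "inj_on ?h W" by (simp add: inj_on_def)
      have "?F t = hform (pick_kernel g) (?h ` W) (\<lambda>z. x (z - complex_of_real t))"
        unfolding hform_def by (simp add: sum.reindex[OF inj])
      moreover have "Re (hform (pick_kernel g) (?h ` W) (\<lambda>z. x (z - complex_of_real t))) \<ge> 0"
        using elim W inj by (intro pos) (auto simp: card_image)
      ultimately show "0 \<le> Re (?F t)" by simp
    qed
    have "0 \<le> Re (hform (pick_kernel G) W x)"
      by (rule tendsto_lowerbound[OF lim ev]) simp
    then show "0 \<le> Re (hform (pick_kernel G) (set zs) x)"
      by (simp only: W_def)
  qed
  with D(3) have "\<exists>S. schur_function S \<and> (\<forall>z\<in>D. S z = G z)"
    unfolding hindmarsh_property_def by simp
  then obtain S where "schur_function S" "\<forall>z\<in>D. S z = G z" by blast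
  then show ?thesis using Gg by auto
qed

section \<open>Stabilisation of the number of negative squares\<close>

lemma negative_family_mono:
  assumes V: "negative_family k W m V" and W: "finite W'" "W \<subseteq> W'"
  shows "negative_family k W' m (\<lambda>i z. if z \<in> W then V i z else 0)"
  unfolding negative_family_def
proof (intro allI impI)
  fix c :: "nat \<Rightarrow> complex" assume c: "\<exists>i<m. c i \<noteq> 0"
  let ?y = "\<lambda>z. \<Sum>i<m. c i * (if z \<in> W then V i z else 0)"
  have "hform k W' ?y = hform k W ?y"
    by (rule hform_subset[OF W]) simp
  also have "\<dots> = hform k W (\<lambda>z. \<Sum>i<m. c i * V i z)"
    by (rule hform_cong) simp
  finally show "Re (hform k W' ?y) < 0"
    using V c unfolding negative_family_def by simp
qed

section \<open>Negative squares of Pick matrices and the numbers \<open>kn\<close>\<close>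

lemma pick_matrix_eq_kernel_matrix: "pick_matrix f zs = kernel_matrix (pick_kernel f) zs"
  by (simp add: pick_matrix_def kernel_matrix_def pick_kernel_def)

lemma sq_minus_pick_matrix:
  assumes "distinct zs"
  shows "sq_minus (pick_matrix f zs) \<le> length zs"
    and "\<exists>V. negative_family (pick_kernel f) (set zs) (sq_minus (pick_matrix f zs)) V"
    and "\<exists>L. nonneg_on_kernel (pick_kernel f) (set zs) (sq_minus (pick_matrix f zs)) L"
  using sq_minus_kernel_matrix[OF assms hermitian_pick_kernel] by (simp_all add: pick_matrix_eq_kernel_matrix)

lemma negative_family_le_sq_minus:
  assumes "negative_family (pick_kernel f) W m V" "distinct zs" "W \<subseteq> set zs"
  shows "m \<le> sq_minus (pick_matrix f zs)"
proof -
  obtain L where "nonneg_on_kernel (pick_kernel f) (set zs) (sq_minus (pick_matrix f zs)) L"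
    using sq_minus_pick_matrix(3)[OF assms(2)] by blast
  with negative_family_mono[OF assms(1) _ assms(3)] show ?thesis
    by (auto intro: negative_family_le_kernel)
qed

lemma point_lists_extend:
  assumes "infinite D" "finite W" "W \<subseteq> D" "card W \<le> n"
  obtains zs where "zs \<in> point_lists D n" "W \<subseteq> set zs"
proof -
  have "infinite (D - W)" using assms by simp
  then obtain W' where W': "W' \<subseteq> D - W" "finite W'" "card W' = n - card W"
    using infinite_arbitrarily_large by metis
  have c: "card (W \<union> W') = n" using W' assms by (subst card_Un_disjoint) auto
  obtain zs where "set zs = W \<union> W'" "distinct zs"
    using finite_distinct_list[of "W \<union> W'"] W'(2) assms(2) by auto
  then have "zs \<in> point_lists D n" "W \<subseteq> set zs"
    using c W'(1) assms(3) distinct_card[of zs] by (auto simp: point_lists_def)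
  then show ?thesis by (rule that)
qed

text \<open>An infinite \<open>D\<close> has point lists of every length, and
  \<open>sq_minus\<close> is bounded by the length, so the supremum in \<open>kn\<close> is a
  maximum.\<close>

lemma kn_attained:
  assumes "infinite D"
  shows "\<And>zs. zs \<in> point_lists D n \<Longrightarrow> sq_minus (pick_matrix f zs) \<le> kn D f n"
    and "\<exists>zs\<in>point_lists D n. sq_minus (pick_matrix f zs) = kn D f n"
proof -
  let ?A = "sq_minus ` pick_matrix f ` point_lists D n"
  have ne: "?A \<noteq> {}" using point_lists_extend[OF assms, of "{}" n] by auto
  have "?A \<subseteq> {..n}"
    using sq_minus_pick_matrix(1) by (auto simp: point_lists_def)
  then have fin: "finite ?A" by (rule finite_subset) simp
  have kn: "kn D f n = Max ?A"
    using ne by (simp add: kn_def Sup_nat_def)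
  show "sq_minus (pick_matrix f zs) \<le> kn D f n" if "zs \<in> point_lists D n" for zs
    unfolding kn by (rule Max_ge[OF fin]) (use that in blast)
  have "kn D f n \<in> ?A" unfolding kn by (rule Max_in[OF fin ne])
  then show "\<exists>zs\<in>point_lists D n. sq_minus (pick_matrix f zs) = kn D f n" by auto
qed

text \<open>Padding \<open>W\<close> to exactly \<open>n\<close> points keeps the family
  negative.\<close>

lemma negative_family_le_kn:
  assumes "infinite D" "negative_family (pick_kernel f) W m V" "finite W" "W \<subseteq> D" "card W \<le> n"
  shows "m \<le> kn D f n"
proof -
  obtain zs where zs: "zs \<in> point_lists D n" "W \<subseteq> set zs"
    using point_lists_extend[OF assms(1,3,4,5)] by blast
  have "m \<le> sq_minus (pick_matrix f zs)"
    using negative_family_le_sq_minus[OF assms(2) _ zs(2)] zs(1) by (simp add: point_lists_def)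
  also have "\<dots> \<le> kn D f n" by (rule kn_attained(1)[OF assms(1) zs(1)])
  finally show ?thesis .
qed

section \<open>Removing and adding points\<close>

lemma hform_add_radical:
  assumes k: "hermitian_kernel k" and y: "\<And>z. z \<in> Z \<Longrightarrow> (\<Sum>w\<in>Z. k z w * y w) = 0"
  shows "hform k Z (\<lambda>z. v z + s * y z) = hform k Z v"
proof -
  have y': "(\<Sum>z\<in>Z. cnj (y z) * k z w) = 0" if "w \<in> Z" for w
    using arg_cong[OF y[OF that], of cnj] k by (simp add: hermitian_kernel_def mult.commute)
  have right: "(\<Sum>z\<in>Z. \<Sum>w\<in>Z. cnj (u z) * k z w * (s * y w)) = 0" for u
  proof (rule sum.neutral, rule ballI)
    fix z assume "z \<in> Z"
    have "(\<Sum>w\<in>Z. cnj (u z) * k z w * (s * y w)) = cnj (u z) * s * (\<Sum>w\<in>Z. k z w * y w)"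
      unfolding sum_distrib_left by (simp add: mult_ac)
    then show "(\<Sum>w\<in>Z. cnj (u z) * k z w * (s * y w)) = 0" using y[OF \<open>z \<in> Z\<close>] by simp
  qed
  have left: "(\<Sum>z\<in>Z. \<Sum>w\<in>Z. cnj (s * y z) * k z w * v w) = 0"
  proof (subst sum.swap, rule sum.neutral, rule ballI)
    fix w assume "w \<in> Z"
    have "(\<Sum>z\<in>Z. cnj (s * y z) * k z w * v w) = cnj s * v w * (\<Sum>z\<in>Z. cnj (y z) * k z w)"
      unfolding sum_distrib_left by (simp add: mult_ac)
    then show "(\<Sum>z\<in>Z. cnj (s * y z) * k z w * v w) = 0" using y'[OF \<open>w \<in> Z\<close>] by simp
  qed
  have "hform k Z (\<lambda>z. v z + s * y z) = (\<Sum>z\<in>Z. \<Sum>w\<in>Z. cnj (v z + s * y z) * k z w * (s * y w))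
      + (\<Sum>z\<in>Z. \<Sum>w\<in>Z. cnj (s * y z) * k z w * v w) + hform k Z v"
    unfolding hform_def sum.distrib[symmetric]
    by (intro sum.cong refl) (simp add: algebra_simps)
  also have "\<dots> = hform k Z v" unfolding right left by simp
  finally show ?thesis .
qed

text \<open>The null vector \<open>y\<close> lies in the radical, so subtracting multiples of it
  does not change the form; the chosen multiples make every vector vanish at \<open>a\<close>. Hence
  a carrier of least cardinality is nonsingular.\<close>

lemma negative_family_drop_point:
  assumes k: "hermitian_kernel k" and V: "negative_family k Z m V" and Z: "finite Z"
    and y: "\<And>z. z \<in> Z \<Longrightarrow> (\<Sum>w\<in>Z. k z w * y w) = 0" and a: "y a \<noteq> 0"
  shows "negative_family k (Z - {a}) m (\<lambda>i z. V i z - V i a / y a * y z)"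
  unfolding negative_family_def
proof (intro allI impI)
  fix c :: "nat \<Rightarrow> complex" assume c: "\<exists>i<m. c i \<noteq> 0"
  define v where "v = (\<lambda>z. \<Sum>i<m. c i * V i z)"
  have eq: "(\<Sum>i<m. c i * (V i z - V i a / y a * y z)) = v z + (- v a / y a) * y z" for z
    by (simp add: v_def right_diff_distrib sum_subtractf sum_distrib_right sum_divide_distrib sum_negf mult.assoc)
  have "hform k (Z - {a}) (\<lambda>z. v z + (- v a / y a) * y z) = hform k Z (\<lambda>z. v z + (- v a / y a) * y z)"
    by (rule hform_subset[symmetric]) (use Z a in auto)
  also have "\<dots> = hform k Z v" by (rule hform_add_radical[OF k y])
  finally show "Re (hform k (Z - {a}) (\<lambda>z. \<Sum>i<m. c i * (V i z - V i a / y a * y z))) < 0"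
    using V c unfolding eq negative_family_def v_def by simp
qed

text \<open>The added vector is \<open>x\<close> on \<open>W\<close> and \<open>- \<tau>\<close> on
  \<open>Z\<close>, so completing the square leaves nothing of it on \<open>Z\<close>. Its value is
  that of the complement at \<open>x\<close>, and it is orthogonal to the old vectors.\<close>

lemma (in schur_complement) negative_family_complement:
  assumes V: "negative_family k Z m V" and W: "finite W" "Z \<inter> W = {}"
    and x: "Re (hform complement W x) < 0"
  shows "\<exists>V'. negative_family k (Z \<union> W) (Suc m) V'"
proof -
  define \<tau> where "\<tau> = (\<lambda>l. \<Sum>w\<in>W. cnj (T w l) * x w)"
  define V' where "V' = (\<lambda>i z. if i < m then (if z \<in> Z then V i z else 0)
    else if z \<in> Z then - \<tau> z else x z)"
  have "negative_family k (Z \<union> W) (Suc m) V'"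
    unfolding negative_family_def
  proof (intro allI impI)
    fix c :: "nat \<Rightarrow> complex" assume c: "\<exists>i<Suc m. c i \<noteq> 0"
    define y where "y = (\<lambda>z. \<Sum>i<Suc m. c i * V' i z)"
    have yW: "y w = c m * x w" if "w \<in> W" for w
    proof -
      have "w \<notin> Z" using that W(2) by auto
      then show ?thesis by (simp add: y_def V'_def)
    qed
    have yZ: "y l + (\<Sum>w\<in>W. cnj (T w l) * y w) = (\<Sum>i<m. c i * V i l)" if "l \<in> Z" for l
    proof -
      have "(\<Sum>w\<in>W. cnj (T w l) * y w) = c m * \<tau> l"
        unfolding \<tau>_def sum_distrib_left by (intro sum.cong refl) (simp add: yW mult_ac)
      moreover have "y l = (\<Sum>i<m. c i * V i l) - c m * \<tau> l"
        using that by (simp add: y_def V'_def)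
      ultimately show ?thesis by simp
    qed
    have "hform complement W y = hform complement W (\<lambda>w. c m * x w)"
      by (rule hform_cong) (rule yW)
    also have "\<dots> = complex_of_real ((cmod (c m))\<^sup>2) * hform complement W x"
      unfolding complex_norm_square hform_def sum_distrib_left
      by (intro sum.cong refl) (simp add: mult_ac)
    finally have 1: "Re (hform complement W y) = (cmod (c m))\<^sup>2 * Re (hform complement W x)"
      by simp
    have 2: "hform k Z (\<lambda>l. y l + (\<Sum>w\<in>W. cnj (T w l) * y w)) = hform k Z (\<lambda>l. \<Sum>i<m. c i * V i l)"
      by (rule hform_cong) (rule yZ)
    have "Re (hform k Z (\<lambda>l. \<Sum>i<m. c i * V i l)) + (cmod (c m))\<^sup>2 * Re (hform complement W x) < 0"
    proof (cases "\<exists>i<m. c i \<noteq> 0")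
      case True
      then have "Re (hform k Z (\<lambda>l. \<Sum>i<m. c i * V i l)) < 0"
        using V unfolding negative_family_def by blast
      moreover have "(cmod (c m))\<^sup>2 * Re (hform complement W x) \<le> 0"
        using x by (intro mult_nonneg_nonpos) auto
      ultimately show ?thesis by simp
    next
      case False
      then have "c m \<noteq> 0" using c less_Suc_eq by auto
      moreover have "hform k Z (\<lambda>l. \<Sum>i<m. c i * V i l) = 0"
        using False by (simp add: hform_def)
      ultimately show ?thesis using x by (simp add: mult_pos_neg)
    qed
    then show "Re (hform k (Z \<union> W) (\<lambda>z. \<Sum>i<Suc m. c i * V' i z)) < 0"
      unfolding y_def[symmetric] hform_complement[OF W] 2 using 1 by simp
  qed
  then show ?thesis by blast
qed

text \<open>The functionals are pulled back along the shift that completes the square. On their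
  common kernel both summands of \<open>hform_complement\<close> are nonnegative, so their number
  stays \<open>m\<close>.\<close>

lemma (in schur_complement) nonneg_on_kernel_complement:
  assumes L: "nonneg_on_kernel k Z m L" and W: "finite W" "Z \<inter> W = {}"
    and pos: "\<And>x. Re (hform complement W x) \<ge> 0"
  shows "\<exists>L'. nonneg_on_kernel k (Z \<union> W) m L'"
proof -
  define L' where "L' = (\<lambda>i z. if z \<in> Z then L i z else \<Sum>l\<in>Z. L i l * cnj (T z l))"
  have "nonneg_on_kernel k (Z \<union> W) m L'"
    unfolding nonneg_on_kernel_def
  proof (intro allI impI)
    fix y assume y: "\<forall>i<m. (\<Sum>z\<in>Z \<union> W. L' i z * y z) = 0"
    have "(\<Sum>l\<in>Z. L i l * (y l + (\<Sum>w\<in>W. cnj (T w l) * y w))) = (\<Sum>z\<in>Z \<union> W. L' i z * y z)" for i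
    proof -
      have "(\<Sum>z\<in>Z \<union> W. L' i z * y z) = (\<Sum>z\<in>Z. L' i z * y z) + (\<Sum>z\<in>W. L' i z * y z)"
        using finite_Z W by (intro sum.union_disjoint) auto
      also have "(\<Sum>z\<in>Z. L' i z * y z) = (\<Sum>z\<in>Z. L i z * y z)"
        by (intro sum.cong refl) (simp add: L'_def)
      also have "(\<Sum>z\<in>W. L' i z * y z) = (\<Sum>z\<in>W. \<Sum>l\<in>Z. L i l * (cnj (T z l) * y z))"
        using W(2) by (intro sum.cong refl) (auto simp: L'_def sum_distrib_right mult.assoc)
      also have "\<dots> = (\<Sum>l\<in>Z. L i l * (\<Sum>w\<in>W. cnj (T w l) * y w))"
        unfolding sum_distrib_left by (rule sum.swap)
      finally show ?thesis by (simp add: distrib_left sum.distrib)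
    qed
    then have "Re (hform k Z (\<lambda>l. y l + (\<Sum>w\<in>W. cnj (T w l) * y w))) \<ge> 0"
      using L y unfolding nonneg_on_kernel_def by simp
    then show "Re (hform k (Z \<union> W) y) \<ge> 0"
      using pos[of y] unfolding hform_complement[OF W] by simp
  qed
  then show ?thesis by blast
qed

theorem pick_forms_bounded_from_stabilization:
  assumes p: "p \<ge> 2" and D: "open D" "D \<subseteq> ball 0 1" "hindmarsh_property p D" "infinite D"
    and kn: "kn D f n = \<kappa>" "kn D f (n + p) = \<kappa>" and zs: "zs \<in> point_lists D m"
  shows "sq_minus (pick_matrix f zs) \<le> \<kappa>"
proof -
  let ?k = "pick_kernel f"
  let ?P = "\<lambda>c. \<exists>Z V. finite Z \<and> Z \<subseteq> D \<and> card Z = c \<and> negative_family ?k Z \<kappa> V"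
  have "?P n"
  proof -
    obtain ys where ys: "ys \<in> point_lists D n" "sq_minus (pick_matrix f ys) = \<kappa>"
      using kn_attained(2)[OF D(4), of n f] kn(1) by auto
    then have dist: "distinct ys" "set ys \<subseteq> D" "length ys = n" by (auto simp: point_lists_def)
    obtain V where "negative_family ?k (set ys) \<kappa> V"
      using sq_minus_pick_matrix(2)[OF dist(1), of f] ys(2) by auto
    then show ?thesis
      using dist distinct_card[OF dist(1)] by (intro exI[of _ "set ys"] exI[of _ V]) simp
  qed
  \<comment> \<open>Minimality will exclude null vectors on \<open>Z\<close>, and
    \<open>c \<le> n\<close> ensures that \<open>Z\<close> with \<open>p\<close> further points
    stays within \<open>n + p\<close> points.\<close>
  define c where "c = (LEAST c. ?P c)"
  have "?P c" unfolding c_def using \<open>?P n\<close> by (rule LeastI)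
  then obtain Z V where Z: "finite Z" "Z \<subseteq> D" "card Z = c" and V: "negative_family ?k Z \<kappa> V"
    by blast
  have "c \<le> n" unfolding c_def using \<open>?P n\<close> by (rule Least_le)
  have min: "c \<le> card Z'" if "finite Z'" "Z' \<subseteq> D" "negative_family ?k Z' \<kappa> V'" for Z' V'
    unfolding c_def by (rule Least_le) (use that in blast)
  have nonsing: "\<forall>w\<in>Z. y w = 0" if y: "\<And>z. z \<in> Z \<Longrightarrow> (\<Sum>w\<in>Z. ?k z w * y w) = 0" for y
  proof (rule ccontr)
    assume "\<not> (\<forall>w\<in>Z. y w = 0)"
    then obtain a where a: "a \<in> Z" "y a \<noteq> 0" by blast
    have "c \<le> card (Z - {a})"
      by (rule min[OF _ _ negative_family_drop_point[OF hermitian_pick_kernel V Z(1) y a(2)]])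
        (use Z in auto)
    then show False using Z a(1) card_Diff1_less[of Z a] by simp
  qed
  have "\<exists>t. \<forall>l\<in>Z. (\<Sum>j\<in>Z. t j * ?k j l) = ?k z l" for z
  proof -
    obtain x where x: "\<forall>l\<in>Z. (\<Sum>w\<in>Z. ?k l w * x w) = ?k l z"
      using nonsingular_system_solvable[OF Z(1) nonsing, where b = "\<lambda>l. ?k l z"] by blast
    have "(\<Sum>j\<in>Z. cnj (x j) * ?k j l) = ?k z l" if "l \<in> Z" for l
      using arg_cong[OF bspec[OF x that], of cnj] hermitian_pick_kernel[of f]
      by (simp add: hermitian_kernel_def mult.commute)
    then show ?thesis by (intro exI[of _ "\<lambda>j. cnj (x j)"]) simp
  qed
  then obtain T where T: "\<And>z l. l \<in> Z \<Longrightarrow> (\<Sum>j\<in>Z. T z j * ?k j l) = ?k z l" by metis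
  interpret pick_complement f Z T
  proof
    show "hermitian_kernel ?k" by (rule hermitian_pick_kernel)
    show "\<forall>j\<in>Z. x j = 0" if x: "\<And>l. l \<in> Z \<Longrightarrow> (\<Sum>j\<in>Z. x j * ?k j l) = 0" for x
    proof -
      have "(\<Sum>w\<in>Z. ?k l w * cnj (x w)) = 0" if "l \<in> Z" for l
        using arg_cong[OF x[OF that], of cnj] hermitian_pick_kernel[of f]
        by (simp add: hermitian_kernel_def mult.commute)
      then have "\<forall>w\<in>Z. cnj (x w) = 0" by (rule nonsing)
      then show ?thesis by simp
    qed
  qed (use Z D(2) T in auto)
  have disc: "cmod z < 1" if "z \<in> D" for z using that D(2) by auto
  \<comment> \<open>A negative value would add a square to the \<kappa> carried by \<open>Z\<close>,
    on at most \<open>n + p\<close> points.\<close>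
  have small: "Re (hform complement W x) \<ge> 0" if W: "W \<subseteq> D - Z" "finite W" "card W \<le> p" for W x
  proof (rule ccontr)
    assume "\<not> Re (hform complement W x) \<ge> 0"
    moreover have disj: "Z \<inter> W = {}" using W(1) by auto
    ultimately obtain V' where "negative_family ?k (Z \<union> W) (Suc \<kappa>) V'"
      using negative_family_complement[OF V W(2), of x] by auto
    then have "Suc \<kappa> \<le> kn D f (n + p)"
      by (rule negative_family_le_kn[OF D(4)])
        (use Z W disj \<open>c \<le> n\<close> in \<open>auto simp: card_Un_disjoint\<close>)
    then show False using kn(2) by simp
  qed
  \<comment> \<open>On the diagonal the displacement identity says that the complement times 1 -
    |z|^2 equals |denom|^2 - |numer|^2. One-point positivity turns a zero of \<open>denom\<close>
    into a common zero, which \<open>no_common_zero\<close> excludes.\<close>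
  have denom: "denom z \<noteq> 0" if z: "z \<in> D - Z" for z
  proof
    assume 0: "denom z = 0"
    have z1: "cmod z < 1" using disc z by auto
    have "Re (hform complement {z} (\<lambda>_. 1)) \<ge> 0" by (rule small) (use z p in auto)
    then have pos: "Re (complement z z) \<ge> 0" by (simp add: hform_def)
    have "1 - z * cnj z = complex_of_real (1 - (cmod z)\<^sup>2)"
      using complex_norm_square[of z] by simp
    moreover have "numer z * cnj (numer z) = complex_of_real ((cmod (numer z))\<^sup>2)"
      using complex_norm_square[of "numer z"] by simp
    ultimately have "complement z z * complex_of_real (1 - (cmod z)\<^sup>2) = - complex_of_real ((cmod (numer z))\<^sup>2)"
      using complement_displacement[OF z1 z1] 0 by simp
    from arg_cong[OF this, of Re]
    have "Re (complement z z) * (1 - (cmod z)\<^sup>2) = - (cmod (numer z))\<^sup>2"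
      by simp
    moreover have "Re (complement z z) * (1 - (cmod z)\<^sup>2) \<ge> 0"
      using pos z1 by (intro mult_nonneg_nonneg) (auto simp: abs_square_le_1)
    ultimately have "(cmod (numer z))\<^sup>2 \<le> 0" by simp
    then have "numer z = 0" by simp
    with 0 no_common_zero[OF z1] z show False by auto
  qed
  define g where "g = (\<lambda>z. numer z / denom z)"
  have compl: "complement z w = denom z * cnj (denom w) * pick_kernel g z w"
    if "z \<in> D - Z" "w \<in> D - Z" for z w
  proof -
    have zw: "cmod z < 1" "cmod w < 1" using that disc by auto
    have "denom z * cnj (denom w) * (1 - g z * cnj (g w))
        = denom z * cnj (denom w) - (denom z * g z) * (cnj (denom w) * cnj (g w))"
      by (simp add: algebra_simps)
    also have "denom z * g z = numer z" using denom[OF that(1)] by (simp add: g_def)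
    also have "cnj (denom w) * cnj (g w) = cnj (numer w)" using denom[OF that(2)] by (simp add: g_def)
    finally show ?thesis
      using complement_displacement[OF zw] unit_disc_denominator[OF zw]
      by (simp add: pick_kernel_def eq_divide_eq)
  qed
  \<comment> \<open>As \<open>denom\<close> has no zeros on \<open>D - Z\<close>, this rescaling is
    invertible and positivity passes both ways between the complement and the Pick kernel of
    \<open>g\<close>.\<close>
  have complement_form: "hform complement W x = hform (pick_kernel g) W (\<lambda>z. cnj (denom z) * x z)"
    if "W \<subseteq> D - Z" for W x
    unfolding hform_scaled[symmetric] unfolding hform_def
    by (intro sum.cong refl) (use that compl in auto)
  have "Re (hform (pick_kernel g) W x) \<ge> 0" if W: "W \<subseteq> D - Z" "finite W" "card W \<le> p" for W x
  proof -
    have "hform complement W (\<lambda>z. x z / cnj (denom z)) = hform (pick_kernel g) W x"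
      unfolding complement_form[OF W(1)] by (rule hform_cong) (use W(1) denom in auto)
    then show ?thesis using small[OF W, of "\<lambda>z. x z / cnj (denom z)"] by simp
  qed
  then obtain S where S: "schur_function S" "\<forall>z\<in>D - Z. S z = g z"
    using hindmarsh_property_punctured[OF p D(1-3) Z(1)] by blast
  \<comment> \<open>The Schur extension replaces positivity on at most \<open>p\<close> points by
    positivity on every finite set.\<close>
  have all: "Re (hform complement W x) \<ge> 0" if W: "W \<subseteq> D - Z" "finite W" for W x
  proof -
    have Sg: "S z = g z" if "z \<in> W" for z using S(2) W(1) that by blast
    have "hform complement W x = hform (pick_kernel S) W (\<lambda>z. cnj (denom z) * x z)"
      unfolding complement_form[OF W(1)] unfolding hform_def pick_kernel_def
      by (intro sum.cong refl) (simp add: Sg)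
    moreover have "W \<subseteq> ball 0 1" using W(1) D(2) by auto
    ultimately show ?thesis
      using schur_function_pick_form_nonneg[OF S(1) W(2)] by simp
  qed
  obtain us where us: "set us = Z" "distinct us" using finite_distinct_list[OF Z(1)] by blast
  let ?s = "sq_minus (pick_matrix f us)"
  have "?s \<le> \<kappa>"
  proof -
    obtain V' where "negative_family ?k Z ?s V'"
      using sq_minus_pick_matrix(2)[OF us(2)] us(1) by auto
    then have "?s \<le> kn D f n"
      by (rule negative_family_le_kn[OF D(4)]) (use Z \<open>c \<le> n\<close> in auto)
    then show ?thesis using kn(1) by simp
  qed
  obtain L where L: "nonneg_on_kernel ?k Z ?s L"
    using sq_minus_pick_matrix(3)[OF us(2)] us(1) by auto
  \<comment> \<open>Passing from \<open>set zs\<close> to \<open>Z \<union> W\<close> preserves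
    negative families, so the functionals extended from \<open>Z\<close> bound the count for
    \<open>zs\<close>.\<close>
  define W where "W = set zs - Z"
  have W: "finite W" "Z \<inter> W = {}" "W \<subseteq> D - Z"
    using zs by (auto simp: W_def point_lists_def)
  obtain L' where L': "nonneg_on_kernel ?k (Z \<union> W) ?s L'"
    using nonneg_on_kernel_complement[OF L W(1,2) all[OF W(3,1)]] by blast
  have "distinct zs" using zs by (simp add: point_lists_def)
  then obtain V' where V': "negative_family ?k (set zs) (sq_minus (pick_matrix f zs)) V'"
    using sq_minus_pick_matrix(2) by blast
  have "finite (Z \<union> W)" "set zs \<subseteq> Z \<union> W" using Z(1) W(1) by (auto simp: W_def)
  from negative_family_le_kernel[OF negative_family_mono[OF V' this] L']
  show ?thesis using \<open>?s \<le> \<kappa>\<close> by simp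
qed

theorem theorem6p3:
  fixes p :: nat and D :: "complex set" and f :: "complex \<Rightarrow> complex" and \<kappa> :: nat
  assumes "p \<ge> 3" and "open D" and "D \<subseteq> ball 0 1" and "hindmarsh_property p D"
  shows "in_S_kappa \<kappa> D f \<longleftrightarrow> (\<exists>n. kn D f n = \<kappa> \<and> kn D f (n + p) = \<kappa>)"
proof (cases "D = {}")
  case True
  \<comment> \<open>Over the empty set only the empty list remains; for \<open>n > 0\<close> the
    supremum in \<open>kn\<close> is \<open>Sup {} = 0\<close>, so both sides amount to
    \<open>\<kappa> = 0\<close>.\<close>
  have pl: "point_lists D n = (if n = 0 then {[]} else {})" for n
    using True by (auto simp: point_lists_def)
  have sq0: "sq_minus (pick_matrix f []) = 0"
    using sq_minus_pick_matrix(1)[of "[]" f] by simp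
  have "kn D f n = 0" for n
    by (simp add: kn_def pl sq0)
  then show ?thesis by (auto simp: in_S_kappa_def pl sq0)
next
  case False
  then have inf: "infinite D" using assms(2) finite_imp_not_open by blast
  show ?thesis
  proof
    assume S: "in_S_kappa \<kappa> D f"
    then obtain n zs where zs: "zs \<in> point_lists D n" "sq_minus (pick_matrix f zs) = \<kappa>"
      by (auto simp: in_S_kappa_def)
    have dist: "distinct zs" "set zs \<subseteq> D" "length zs = n" using zs by (auto simp: point_lists_def)
    obtain V where V: "negative_family (pick_kernel f) (set zs) \<kappa> V"
      using sq_minus_pick_matrix(2)[OF dist(1), of f] zs(2) by auto
    \<comment> \<open>Once \<kappa> is attained it persists: the negative family survives the
      addition of points, and membership in the class caps the count.\<close>
    have "kn D f m = \<kappa>" if "m \<ge> n" for m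
    proof (rule antisym)
      obtain ys where "ys \<in> point_lists D m" "sq_minus (pick_matrix f ys) = kn D f m"
        using kn_attained(2)[OF inf, of m f] by blast
      then show "kn D f m \<le> \<kappa>" using S unfolding in_S_kappa_def by metis
      show "\<kappa> \<le> kn D f m"
        by (rule negative_family_le_kn[OF inf V]) (use dist that distinct_card[OF dist(1)] in auto)
    qed
    then show "\<exists>n. kn D f n = \<kappa> \<and> kn D f (n + p) = \<kappa>" by (intro exI[of _ n]) simp
  next
    assume "\<exists>n. kn D f n = \<kappa> \<and> kn D f (n + p) = \<kappa>"
    then obtain n where n: "kn D f n = \<kappa>" "kn D f (n + p) = \<kappa>" by blast
    have "sq_minus (pick_matrix f zs) \<le> \<kappa>" if "zs \<in> point_lists D m" for zs m
      using pick_forms_bounded_from_stabilization[OF _ assms(2-4) inf n that] assms(1) by simp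
    moreover obtain zs where "zs \<in> point_lists D n" "sq_minus (pick_matrix f zs) = \<kappa>"
      using kn_attained(2)[OF inf, of n f] n(1) by auto
    ultimately show "in_S_kappa \<kappa> D f" unfolding in_S_kappa_def by blast
  qed
qed

end
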